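(* Assume $\lambda_1(-L)>0$, and let $\rho>0$ and $\kappa\in\mathbb R$ be such that for all $x\in\mathbb R$, $$\frac{V''(x)}{2}+\frac{V'(x)^2}{4}+\frac{\rho}{2}-\frac{\rho^2x^2}{4}\ \ge\ \kappa.$$ Then for every integer $n\ge1$, $$\lambda_n(-L)\ \ge\ \rho(n-1)+\kappa .$$
   Context: $V\in C^\infty(\mathbb R)$ with $\int e^{-V}dx<\infty$, $\mu$ the probability measure with density proportional to $e^{-V}$, $Lf=f''-V'f'$, self-adjoint in $L^2(\mu)$ (unique extension from $C_0^\infty(\mathbb R)$). $\lambda_0(-L)=0$ and for $n\ge1$, $\lambda_n(-L)=\sup_{g_0,\dots,g_{n-1}\in L^2(\mu)}\inf_{f\in D(-L)\setminus\{0\},\,f\perp_\mu g_i}\frac{\int f(-Lf)\,d\mu}{\int f^2d\mu}$; $\lambda_1(-L)$ is the spectral gap. *)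

theory Defs
  imports "HOL-Analysis.Analysis"
begin

definition smooth_fun :: "(real \<Rightarrow> real) \<Rightarrow> bool" where
  "smooth_fun f \<longleftrightarrow> (\<forall>k x. ((deriv ^^ k) f) differentiable (at x))"

definition test_fun :: "(real \<Rightarrow> real) \<Rightarrow> bool" where
  "test_fun f \<longleftrightarrow> smooth_fun f \<and> bounded {x. f x \<noteq> 0}"

definition mu :: "(real \<Rightarrow> real) \<Rightarrow> real measure" where
  "mu V = density lborel (\<lambda>x. ennreal (exp (- V x) / (\<integral>y. exp (- V y) \<partial>lborel)))"

definition L2 :: "(real \<Rightarrow> real) \<Rightarrow> (real \<Rightarrow> real) \<Rightarrow> bool" where
  "L2 V f \<longleftrightarrow> f \<in> borel_measurable borel \<and> integrable (mu V) (\<lambda>x. (f x)\<^sup>2)"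

definition gen :: "(real \<Rightarrow> real) \<Rightarrow> (real \<Rightarrow> real) \<Rightarrow> real \<Rightarrow> real" where
  "gen V f x = deriv (deriv f) x - deriv V x * deriv f x"

text \<open>Graph of the closure in L2(mu) of L defined on test functions:
  (f, h) is in the graph iff there are test functions phi_k with phi_k \<rightarrow> f and
  L phi_k \<rightarrow> h in L2(mu). This closure is the (unique) self-adjoint extension of L;
  h is then L f.\<close>
definition Lgraph :: "(real \<Rightarrow> real) \<Rightarrow> (real \<Rightarrow> real) \<Rightarrow> (real \<Rightarrow> real) \<Rightarrow> bool" where
  "Lgraph V f h \<longleftrightarrow> L2 V f \<and> L2 V h \<and>
     (\<exists>\<phi> :: nat \<Rightarrow> real \<Rightarrow> real. (\<forall>k. test_fun (\<phi> k)) \<and>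
        ((\<lambda>k. \<integral>x. (\<phi> k x - f x)\<^sup>2 \<partial>mu V) \<longlonglongrightarrow> 0) \<and>
        ((\<lambda>k. \<integral>x. (gen V (\<phi> k) x - h x)\<^sup>2 \<partial>mu V) \<longlonglongrightarrow> 0))"

definition rayleigh_set :: "(real \<Rightarrow> real) \<Rightarrow> nat \<Rightarrow> (nat \<Rightarrow> real \<Rightarrow> real) \<Rightarrow> real set" where
  "rayleigh_set V n g = {(\<integral>x. f x * (- h x) \<partial>mu V) / (\<integral>x. (f x)\<^sup>2 \<partial>mu V) | f h.
      Lgraph V f h \<and> (\<integral>x. (f x)\<^sup>2 \<partial>mu V) \<noteq> 0 \<and>
      (\<forall>i<n. (\<integral>x. f x * g i x \<partial>mu V) = 0)}"

definition lambda :: "(real \<Rightarrow> real) \<Rightarrow> nat \<Rightarrow> ereal" where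
  "lambda V n = (if n = 0 then 0 else
     (SUP g \<in> {g :: nat \<Rightarrow> real \<Rightarrow> real. \<forall>i<n. L2 V (g i)}.
        (INF r \<in> rayleigh_set V n g. ereal r)))"

end

theory Submission
  imports Defs "HOL-Probability.Distributions"
begin

text \<open>
  For \<open>W = V / 2\<close> put \<open>A w = w' + W' w\<close> and \<open>A* w = - w' + W' w\<close> on \<open>L\<^sup>2(dx)\<close>. The substitution
  \<open>w = f exp (- V / 2)\<close> turns \<open>- L\<close> into \<open>A* A\<close>, whereas \<open>A A*\<close> has the potential \<open>V'\<^sup>2 / 4 + V'' / 2\<close>, which
  by hypothesis exceeds that of the harmonic oscillator \<open>a* a\<close>, given by \<open>W = \<rho> x\<^sup>2 / 4\<close>, by at
  least \<open>\<kappa>\<close>.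

  The argument rests on one step: a bound \<open>A A* \<ge> c\<close> off \<open>m\<close> directions gives \<open>A* A \<ge> c\<close> off
  \<open>m + 1\<close> directions. Indeed, if \<open>w\<close> is orthogonal to \<open>exp (- W)\<close>, then \<open>w = A* v\<close> for some \<open>v\<close>, and
  \<open>|w|\<^sup>2 = \<langle>A w, v\<rangle> \<le> |A w| |v|\<close>, while \<open>c |v|\<^sup>2 \<le> |A* v|\<^sup>2 = |w|\<^sup>2\<close>. Since \<open>a a* = a* a + \<rho>\<close>,
  iterating the step gives \<open>a* a \<ge> \<rho> m\<close> off \<open>m\<close> directions; applying it once more, to \<open>V\<close>, gives
  the theorem. Allowing an arbitrarily small loss in the constant, the directions can be cut off to
  have compact support, so that only compactly supported functions occur: then \<open>v\<close> is again one,
  and the bound passes to the closure of \<open>L\<close>.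
\<close>

section \<open>Square-integrable functions\<close>

text \<open>The measure is a parameter because the estimates run both in \<open>lborel\<close>, for
  the transformed functions, and in \<open>mu V\<close>, for the generator.\<close>

definition square_integrable :: "'a measure \<Rightarrow> ('a \<Rightarrow> real) \<Rightarrow> bool" where
  "square_integrable M f \<longleftrightarrow> f \<in> borel_measurable M \<and> integrable M (\<lambda>x. (f x)\<^sup>2)"

lemma square_integrable_mult:
  assumes "square_integrable M f" "square_integrable M g"
  shows "integrable M (\<lambda>x. f x * g x)"
proof (rule Bochner_Integration.integrable_bound)
  show "integrable M (\<lambda>x. (f x)\<^sup>2 + (g x)\<^sup>2)" "(\<lambda>x. f x * g x) \<in> borel_measurable M"
    using assms by (auto simp: square_integrable_def)
  have "\<bar>f x * g x\<bar> \<le> (f x)\<^sup>2 + (g x)\<^sup>2" for x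
  proof -
    have "0 \<le> (\<bar>f x\<bar> - \<bar>g x\<bar>)\<^sup>2" by simp
    then have "2 * \<bar>f x * g x\<bar> \<le> (f x)\<^sup>2 + (g x)\<^sup>2"
      by (simp add: power2_eq_square algebra_simps abs_mult)
    then show ?thesis by linarith
  qed
  then show "AE x in M. norm (f x * g x) \<le> norm ((f x)\<^sup>2 + (g x)\<^sup>2)"
    by (auto intro!: AE_I2 order_trans[OF _ abs_ge_self])
qed

lemma square_integrable_add:
  assumes "square_integrable M f" "square_integrable M g"
  shows "square_integrable M (\<lambda>x. f x + g x)"
  using assms square_integrable_mult[OF assms]
  by (auto simp: square_integrable_def power2_sum mult.assoc)

lemma square_integrable_cmult:
  assumes "square_integrable M f"
  shows "square_integrable M (\<lambda>x. c * f x)"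
  using assms by (auto simp: square_integrable_def power_mult_distrib)

lemma square_integrable_diff:
  assumes "square_integrable M f" "square_integrable M g"
  shows "square_integrable M (\<lambda>x. f x - g x)"
  using square_integrable_add[OF assms(1) square_integrable_cmult[OF assms(2), of "-1"]] by simp

text \<open>The integral of \<open>(s f - t g)^2\<close> is a nonnegative quadratic form in
  \<open>s\<close> and \<open>t\<close>; a suitable choice of the two gives the inequality.\<close>

lemma integral_Cauchy_Schwarz:
  fixes f g :: "'a \<Rightarrow> real"
  assumes "square_integrable M f" "square_integrable M g"
  shows "(\<integral>x. f x * g x \<partial>M)\<^sup>2 \<le> (\<integral>x. (f x)\<^sup>2 \<partial>M) * (\<integral>x. (g x)\<^sup>2 \<partial>M)"
proof -
  let ?a = "\<integral>x. (f x)\<^sup>2 \<partial>M" and ?b = "\<integral>x. f x * g x \<partial>M" and ?c = "\<integral>x. (g x)\<^sup>2 \<partial>M"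
  note i = square_integrable_mult[OF assms]
  have q: "0 \<le> ?a * s\<^sup>2 - 2 * s * t * ?b + ?c * t\<^sup>2" for s t :: real
  proof -
    have "0 \<le> (\<integral>x. (s * f x - t * g x)\<^sup>2 \<partial>M)" by simp
    also have "\<dots> = (\<integral>x. s\<^sup>2 * (f x)\<^sup>2 - 2 * s * t * (f x * g x) + t\<^sup>2 * (g x)\<^sup>2 \<partial>M)"
      by (intro Bochner_Integration.integral_cong refl) (simp add: power2_eq_square algebra_simps)
    also have "\<dots> = ?a * s\<^sup>2 - 2 * s * t * ?b + ?c * t\<^sup>2"
      using assms i by (simp add: square_integrable_def)
    finally show ?thesis .
  qed
  have nn: "?a \<ge> 0" "?c \<ge> 0" by auto
  show ?thesis
  proof (cases "?a = 0")
    case True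
    have "?b = 0"
    proof (rule ccontr)
      assume "?b \<noteq> 0"
      \<comment> \<open>With \<open>?a = 0\<close> and \<open>t = 1\<close> the form is affine in
        \<open>s\<close>; this \<open>s\<close> would give it the value -1.\<close>
      define s where "s = (?c + 1) / (2 * ?b)"
      have "s * ?b = (?c + 1) / 2" using \<open>?b \<noteq> 0\<close> by (simp add: s_def)
      moreover have "0 \<le> ?c - 2 * (s * ?b)" using q[of s 1] True by (simp add: mult_ac)
      ultimately show False by simp
    qed
    then show ?thesis using True by simp
  next
    case False
    then have "?a > 0" using nn by linarith
    \<comment> \<open>For \<open>t = ?a\<close> the form is minimal at
      \<open>s = ?b\<close>.\<close>
    have "0 \<le> ?a * ?b\<^sup>2 - 2 * ?b * ?a * ?b + ?c * ?a\<^sup>2" using q[of ?b ?a] .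
    then have "?a * ?b\<^sup>2 \<le> ?a * (?a * ?c)" by (simp add: power2_eq_square algebra_simps)
    then show ?thesis using \<open>?a > 0\<close> by simp
  qed
qed

text \<open>The difference of the products splits as
  \<open>u v - f g = (u - f) (v - g) + (u - f) g + f (v - g)\<close>, and each term tends to 0 by
  Cauchy-Schwarz. This carries energies and pairings to the limit in \<open>Lgraph\<close>.\<close>

lemma square_integrable_tendsto_mult:
  fixes f g :: "'a \<Rightarrow> real" and u v :: "nat \<Rightarrow> 'a \<Rightarrow> real"
  assumes "square_integrable M f" "square_integrable M g"
    and "\<And>k. square_integrable M (u k)" "\<And>k. square_integrable M (v k)"
    and u: "(\<lambda>k. \<integral>x. (u k x - f x)\<^sup>2 \<partial>M) \<longlonglongrightarrow> 0" and v: "(\<lambda>k. \<integral>x. (v k x - g x)\<^sup>2 \<partial>M) \<longlonglongrightarrow> 0"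
  shows "(\<lambda>k. \<integral>x. u k x * v k x \<partial>M) \<longlonglongrightarrow> (\<integral>x. f x * g x \<partial>M)"
proof -
  let ?du = "\<lambda>k x. u k x - f x" and ?dv = "\<lambda>k x. v k x - g x"
  have sdu: "square_integrable M (?du k)" and sdv: "square_integrable M (?dv k)" for k
    using assms by (auto intro!: square_integrable_diff)
  have sq: "(\<lambda>k. \<integral>x. p k x * q k x \<partial>M) \<longlonglongrightarrow> 0"
    if "\<And>k. square_integrable M (p k)" "\<And>k. square_integrable M (q k)"
      and lim: "(\<lambda>k. (\<integral>x. (p k x)\<^sup>2 \<partial>M) * (\<integral>x. (q k x)\<^sup>2 \<partial>M)) \<longlonglongrightarrow> 0"
    for p q :: "nat \<Rightarrow> 'a \<Rightarrow> real"
  proof -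
    have "(\<lambda>k. (\<integral>x. p k x * q k x \<partial>M)\<^sup>2) \<longlonglongrightarrow> 0"
      by (rule tendsto_sandwich[OF _ _ tendsto_const lim])
        (auto intro!: always_eventually integral_Cauchy_Schwarz that)
    then show ?thesis by simp
  qed
  have "(\<lambda>k. (\<integral>x. ?du k x * ?dv k x \<partial>M) + (\<integral>x. ?du k x * g x \<partial>M) + (\<integral>x. f x * ?dv k x \<partial>M)
      + (\<integral>x. f x * g x \<partial>M)) \<longlonglongrightarrow> 0 + 0 + 0 + (\<integral>x. f x * g x \<partial>M)"
    by (intro tendsto_add sq tendsto_const sdu sdv assms(1,2))
      (use tendsto_mult[OF u v] tendsto_mult[OF u tendsto_const] tendsto_mult[OF tendsto_const v] in auto)
  moreover have "(\<integral>x. ?du k x * ?dv k x \<partial>M) + (\<integral>x. ?du k x * g x \<partial>M) + (\<integral>x. f x * ?dv k x \<partial>M)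
      + (\<integral>x. f x * g x \<partial>M) = (\<integral>x. u k x * v k x \<partial>M)" for k
  proof -
    have "(\<integral>x. u k x * v k x \<partial>M)
        = (\<integral>x. ?du k x * ?dv k x + ?du k x * g x + f x * ?dv k x + f x * g x \<partial>M)"
      by (intro Bochner_Integration.integral_cong refl) (simp add: algebra_simps)
    also have "\<dots> = (\<integral>x. ?du k x * ?dv k x \<partial>M) + (\<integral>x. ?du k x * g x \<partial>M) + (\<integral>x. f x * ?dv k x \<partial>M)
      + (\<integral>x. f x * g x \<partial>M)"
      using square_integrable_mult[OF sdu sdv] square_integrable_mult[OF sdu assms(2)]
        square_integrable_mult[OF assms(1) sdv] square_integrable_mult[OF assms(1,2)]
      by (simp only: Bochner_Integration.integral_add Bochner_Integration.integrable_add)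
    finally show ?thesis by simp
  qed
  ultimately show ?thesis by simp
qed

section \<open>Compactly supported functions on the line\<close>

definition Cc :: "(real \<Rightarrow> real) \<Rightarrow> bool" where
  "Cc f \<longleftrightarrow> continuous_on UNIV f \<and> (\<exists>M. \<forall>x. M < \<bar>x\<bar> \<longrightarrow> f x = 0)"

definition C1c :: "(real \<Rightarrow> real) \<Rightarrow> bool" where
  "C1c f \<longleftrightarrow> (\<forall>x. (f has_real_derivative deriv f x) (at x)) \<and> Cc f \<and> Cc (deriv f)"

lemma Cc_bound:
  assumes "Cc f" obtains M where "M > 0" "\<And>x. M < \<bar>x\<bar> \<Longrightarrow> f x = 0"
proof -
  obtain M where "\<forall>x. M < \<bar>x\<bar> \<longrightarrow> f x = 0" using assms by (auto simp: Cc_def)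
  then show ?thesis by (intro that[of "\<bar>M\<bar> + 1"]) auto
qed

lemma Cc_continuous: "Cc f \<Longrightarrow> continuous_on UNIV f"
  by (simp add: Cc_def)

lemma Cc_mult_continuous:
  assumes "Cc f" "continuous_on UNIV g"
  shows "Cc (\<lambda>x. f x * g x)" "Cc (\<lambda>x. g x * f x)"
  using assms by (auto simp: Cc_def intro!: continuous_intros)

lemma Cc_mult: "Cc f \<Longrightarrow> Cc g \<Longrightarrow> Cc (\<lambda>x. f x * g x)"
  by (rule Cc_mult_continuous) (auto simp: Cc_def)

lemma Cc_add:
  assumes "Cc f" "Cc g" shows "Cc (\<lambda>x. f x + g x)"
proof -
  obtain M N where "\<And>x. M < \<bar>x\<bar> \<Longrightarrow> f x = 0" "\<And>x. N < \<bar>x\<bar> \<Longrightarrow> g x = 0"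
    using assms by (auto simp: Cc_def)
  then have "\<forall>x. max M N < \<bar>x\<bar> \<longrightarrow> f x + g x = 0" by auto
  moreover have "continuous_on UNIV (\<lambda>x. f x + g x)"
    using assms by (auto simp: Cc_def intro!: continuous_intros)
  ultimately show ?thesis unfolding Cc_def by blast
qed

lemma Cc_cmult: "Cc f \<Longrightarrow> Cc (\<lambda>x. c * f x)"
  by (rule Cc_mult_continuous) auto

lemma Cc_minus: "Cc f \<Longrightarrow> Cc (\<lambda>x. - f x)"
  using Cc_cmult[of f "-1"] by simp

lemma Cc_diff: "Cc f \<Longrightarrow> Cc g \<Longrightarrow> Cc (\<lambda>x. f x - g x)"
  using Cc_add[of f "\<lambda>x. - g x"] Cc_minus by simp

lemma Cc_power2: "Cc f \<Longrightarrow> Cc (\<lambda>x. (f x)\<^sup>2)"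
  using Cc_mult[of f f] by (simp add: power2_eq_square)

lemmas Cc_intros = Cc_add Cc_diff Cc_minus Cc_cmult Cc_power2 Cc_mult Cc_mult_continuous

lemma continuous_on_imp_borel:
  fixes f :: "real \<Rightarrow> real" shows "continuous_on UNIV f \<Longrightarrow> f \<in> borel_measurable borel"
  by (rule borel_measurable_continuous_onI)

lemma Cc_integrable:
  assumes "Cc f" shows "integrable lborel f"
proof -
  obtain M where M: "M > 0" "\<And>x. M < \<bar>x\<bar> \<Longrightarrow> f x = 0" using Cc_bound[OF assms] by blast
  have "integrable lborel (\<lambda>x. indicator {-M..M} x *\<^sub>R f x)"
    using assms by (intro borel_integrable_compact) (auto simp: Cc_def intro: continuous_on_subset)
  moreover have "(\<lambda>x. indicator {-M..M} x *\<^sub>R f x) = f"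
    using M by (force simp: indicator_def)
  ultimately show ?thesis by simp
qed

lemma Cc_square_integrable: "Cc f \<Longrightarrow> square_integrable lborel f"
  using Cc_integrable[OF Cc_power2] by (auto simp: square_integrable_def Cc_def intro: continuous_on_imp_borel)

lemma C1c_Cc: "C1c f \<Longrightarrow> Cc f" and C1c_deriv: "C1c f \<Longrightarrow> Cc (deriv f)"
  by (auto simp: C1c_def)

lemma C1cI:
  assumes d: "\<And>x. (f has_real_derivative f' x) (at x)" and "continuous_on UNIV f'"
    and z: "\<And>x. M < \<bar>x\<bar> \<Longrightarrow> f x = 0"
  shows "C1c f" "deriv f = f'"
proof -
  show df: "deriv f = f'" using d by (auto intro!: ext DERIV_imp_deriv)
  have cf: "continuous_on UNIV f"
    using d by (meson DERIV_isCont continuous_at_imp_continuous_on)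
  have "f' x = 0" if "M < \<bar>x\<bar>" for x
  proof -
    \<comment> \<open>The region beyond \<open>M\<close> is open, so \<open>f\<close> vanishes near
      \<open>x\<close> and its derivative there is 0.\<close>
    have "eventually (\<lambda>y. M < \<bar>y\<bar>) (nhds x)"
      using that by (intro order_tendstoD(1)[where y = "\<bar>x\<bar>"] tendsto_rabs tendsto_ident_at) (auto simp: filterlim_ident)
    then have "eventually (\<lambda>y. f y = 0) (nhds x)" by eventually_elim (rule z)
    then have "(f has_real_derivative 0) (at x)"
      by (subst DERIV_cong_ev[OF refl _ refl]) auto
    then show ?thesis using d DERIV_unique by blast
  qed
  then show "C1c f" unfolding C1c_def df Cc_def using cf d assms by auto
qed

lemma C1c_bound:
  assumes "C1c f" obtains M where "M > 0" "\<And>x. M < \<bar>x\<bar> \<Longrightarrow> f x = 0" "\<And>x. M < \<bar>x\<bar> \<Longrightarrow> deriv f x = 0"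
proof -
  obtain M N where "M > 0" "\<And>x. M < \<bar>x\<bar> \<Longrightarrow> f x = 0" "N > 0" "\<And>x. N < \<bar>x\<bar> \<Longrightarrow> deriv f x = 0"
    using Cc_bound[OF C1c_Cc[OF assms]] Cc_bound[OF C1c_deriv[OF assms]] by metis
  then show ?thesis by (intro that[of "max M N"]) auto
qed

lemma C1c_mult:
  assumes "C1c f" and d: "\<And>x. (g has_real_derivative g' x) (at x)" and "continuous_on UNIV g'"
  shows "C1c (\<lambda>x. f x * g x)" "deriv (\<lambda>x. f x * g x) = (\<lambda>x. deriv f x * g x + f x * g' x)"
proof -
  obtain M where M: "\<And>x. M < \<bar>x\<bar> \<Longrightarrow> f x = 0" using C1c_bound[OF assms(1)] by metis
  have df: "(f has_real_derivative deriv f x) (at x)" for x using assms(1) by (auto simp: C1c_def)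
  have cg: "continuous_on UNIV g"
    using d by (meson DERIV_isCont continuous_at_imp_continuous_on)
  have cf: "continuous_on UNIV f" "continuous_on UNIV (deriv f)" using assms(1) by (auto simp: C1c_def Cc_def)
  have 1: "((\<lambda>x. f x * g x) has_real_derivative (deriv f x * g x + f x * g' x)) (at x)" for x
    using DERIV_mult[OF df d] by (simp add: mult.commute)
  have 2: "continuous_on UNIV (\<lambda>x. deriv f x * g x + f x * g' x)"
    using cg cf assms(3) by (auto intro!: continuous_intros)
  show "C1c (\<lambda>x. f x * g x)" "deriv (\<lambda>x. f x * g x) = (\<lambda>x. deriv f x * g x + f x * g' x)"
    using C1cI[OF 1 2, of M] M by auto
qed

lemma C1c_diff_cmult:
  assumes "C1c f" "C1c g"
  shows "C1c (\<lambda>x. f x - c * g x)" "deriv (\<lambda>x. f x - c * g x) = (\<lambda>x. deriv f x - c * deriv g x)"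
proof -
  obtain M N where M: "\<And>x. M < \<bar>x\<bar> \<Longrightarrow> f x = 0" "\<And>x. N < \<bar>x\<bar> \<Longrightarrow> g x = 0"
    using C1c_bound[OF assms(1)] C1c_bound[OF assms(2)] by metis
  have 1: "((\<lambda>x. f x - c * g x) has_real_derivative (deriv f x - c * deriv g x)) (at x)" for x
    using assms by (auto simp: C1c_def intro!: derivative_eq_intros)
  have 2: "continuous_on UNIV (\<lambda>x. deriv f x - c * deriv g x)"
    using assms by (auto simp: C1c_def Cc_def intro!: continuous_intros)
  show "C1c (\<lambda>x. f x - c * g x)" "deriv (\<lambda>x. f x - c * g x) = (\<lambda>x. deriv f x - c * deriv g x)"
    using C1cI[OF 1 2, of "max M N"] M by auto
qed

section \<open>Integration by parts and antiderivatives of compactly supported functions\<close>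

lemma integral_Cc_FTC:
  assumes "continuous_on UNIV g" "\<And>x. M < \<bar>x\<bar> \<Longrightarrow> g x = 0" "M > 0"
    and d: "\<And>x. (G has_real_derivative g x) (at x)"
  shows "(\<integral>x. g x \<partial>lborel) = G M - G (- M)"
proof -
  have "(\<integral>x. g x * indicator {-M..M} x \<partial>lborel) = G M - G (- M)"
    by (rule integral_FTC_Icc_real) (use assms in \<open>auto simp: continuous_on_eq_continuous_at\<close>)
  moreover have "(\<lambda>x. g x * indicator {-M..M} x) = g"
    using assms by (force simp: indicator_def)
  ultimately show ?thesis by simp
qed

lemma integral_deriv_C1c:
  assumes "C1c f" shows "(\<integral>x. deriv f x \<partial>lborel) = 0"
proof -
  obtain M where M: "M > 0" "\<And>x. M < \<bar>x\<bar> \<Longrightarrow> f x = 0" "\<And>x. M < \<bar>x\<bar> \<Longrightarrow> deriv f x = 0"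
    using C1c_bound[OF assms] by blast
  \<comment> \<open>\<open>f\<close> is known to vanish only strictly beyond \<open>M\<close>, hence
    the endpoints at distance \<open>M + 1\<close>.\<close>
  have "(\<integral>x. deriv f x \<partial>lborel) = f (M + 1) - f (- (M + 1))"
    using assms M by (intro integral_Cc_FTC) (auto simp: C1c_def Cc_def)
  then show ?thesis using M by simp
qed

lemma integral_by_parts_C1c:
  assumes "C1c f" and d: "\<And>x. (g has_real_derivative g' x) (at x)" and "continuous_on UNIV g'"
  shows "(\<integral>x. deriv f x * g x \<partial>lborel) = - (\<integral>x. f x * g' x \<partial>lborel)"
proof -
  have cg: "continuous_on UNIV g"
    using d by (meson DERIV_isCont continuous_at_imp_continuous_on)
  have "0 = (\<integral>x. deriv f x * g x + f x * g' x \<partial>lborel)"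
    using integral_deriv_C1c[OF C1c_mult(1)[OF assms]] C1c_mult(2)[OF assms] by simp
  also have "\<dots> = (\<integral>x. deriv f x * g x \<partial>lborel) + (\<integral>x. f x * g' x \<partial>lborel)"
    using assms cg by (intro Bochner_Integration.integral_add Cc_integrable Cc_mult_continuous) (auto simp: C1c_def)
  finally show ?thesis by simp
qed

lemma continuous_antiderivative:
  fixes g :: "real \<Rightarrow> real"
  assumes "continuous_on UNIV g" obtains G where "\<And>x. (G has_real_derivative g x) (at x)"
proof -
  have "\<exists>F. \<forall>x. -\<infinity> < ereal x \<longrightarrow> ereal x < \<infinity> \<longrightarrow> (F has_vector_derivative g x) (at x)"
    using assms by (intro einterval_antiderivative) (auto simp: continuous_on_eq_continuous_at)
  then show ?thesis using that by (auto simp: has_real_derivative_iff_has_vector_derivative)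
qed

lemma antiderivative_const_off_support:
  fixes G :: "real \<Rightarrow> real"
  assumes d: "\<And>x. (G has_real_derivative g x) (at x)" and "\<And>x. M < \<bar>x\<bar> \<Longrightarrow> g x = 0" "M > 0"
  shows "x > M \<Longrightarrow> G x = G M" "x < - M \<Longrightarrow> G x = G (- M)"
proof -
  have c: "continuous_on S G" for S
    using d by (meson DERIV_isCont continuous_at_imp_continuous_on)
  show "G x = G M" if "x > M"
    using that assms(2,3) d c by (intro DERIV_isconst_end[of M x G]) (metis abs_of_pos dual_order.strict_trans)+
  show "G x = G (- M)" if "x < - M"
  proof -
    have "(G has_real_derivative 0) (at y)" if "x < y" "y < - M" for y
      using d[of y] assms(2)[of y] that by simp
    then show ?thesis using DERIV_isconst_end[of x "-M" G] that c by simp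
  qed
qed

text \<open>The antiderivative is constant beyond either end of the support and continuous on the
  compact interval between. This bound later makes the transported directions square
  integrable.\<close>

lemma Cc_antiderivative_bounded:
  assumes "Cc g" and d: "\<And>x. (G has_real_derivative g x) (at x)"
  obtains B where "\<And>x. \<bar>G x\<bar> \<le> B"
proof -
  obtain M where M: "M > 0" "\<And>x. M < \<bar>x\<bar> \<Longrightarrow> g x = 0" using Cc_bound[OF assms(1)] by blast
  have c: "continuous_on {-M..M} G"
    using d by (meson DERIV_isCont continuous_at_imp_continuous_on)
  then have "bounded (G ` {-M..M})" by (intro compact_imp_bounded compact_continuous_image) auto
  then obtain B where B: "\<And>x. x \<in> {-M..M} \<Longrightarrow> \<bar>G x\<bar> \<le> B"
    unfolding bounded_iff by (metis image_eqI real_norm_def)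
  have "\<bar>G x\<bar> \<le> B" for x
    using antiderivative_const_off_support[OF d M(2) M(1), of x] B[of x] B[of M] B[of "-M"] M(1)
    by (cases "x > M"; cases "x < - M") auto
  then show ?thesis by (rule that)
qed

text \<open>Zero mean forces the constants taken by an antiderivative on the two sides of the
  support to agree; subtracting the common value leaves compact support. Here orthogonality to
  \<open>exp (- W)\<close> will enter.\<close>

lemma Cc_antiderivative_C1c:
  assumes "Cc g" "(\<integral>x. g x \<partial>lborel) = 0"
  obtains F where "C1c F" "deriv F = g"
proof -
  obtain M where M: "M > 0" "\<And>x. M < \<bar>x\<bar> \<Longrightarrow> g x = 0" using Cc_bound[OF assms(1)] by blast
  have cg: "continuous_on UNIV g" using assms by (auto simp: Cc_def)
  obtain G where G: "\<And>x. (G has_real_derivative g x) (at x)" using continuous_antiderivative[OF cg] by blast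
  have eq: "G M = G (- M)" using integral_Cc_FTC[OF cg M(2) M(1) G] assms by simp
  let ?F = "\<lambda>x. G x - G M"
  have dF: "(?F has_real_derivative g x) (at x)" for x using G by (auto intro!: derivative_eq_intros)
  have "?F x = 0" if "M < \<bar>x\<bar>" for x
    using antiderivative_const_off_support[OF G M(2) M(1), of x] eq that by (cases "x > M") auto
  then show ?thesis using that C1cI[OF dF cg, of M] by blast
qed

section \<open>Lower bounds off finitely many directions\<close>

text \<open>Truncation and dominated convergence; continuity of \<open>\<theta>\<close> keeps the
  truncated function in \<open>Cc\<close>.\<close>

lemma Cc_dense:
  assumes "continuous_on UNIV \<theta>" "square_integrable lborel \<theta>" "\<epsilon> > 0"
  obtains \<eta> where "Cc \<eta>" "(\<integral>x. (\<theta> x - \<eta> x)\<^sup>2 \<partial>lborel) < \<epsilon>"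
proof -
  \<comment> \<open>Equal to 1 for \<open>|x| \<le> k\<close>, to 0 for
    \<open>|x| \<ge> k + 1\<close>, and linear in between.\<close>
  define cut where "cut k x = max 0 (min 1 (real k + 1 - \<bar>x\<bar>))" for k and x :: real
  have cont: "continuous_on UNIV (cut k)" for k unfolding cut_def by (intro continuous_intros)
  have b\<theta>: "\<theta> \<in> borel_measurable borel" using assms by (auto simp: square_integrable_def)
  have "(\<lambda>k. \<integral>x. (\<theta> x - \<theta> x * cut k x)\<^sup>2 \<partial>lborel) \<longlonglongrightarrow> (\<integral>x. 0 \<partial>(lborel :: real measure))"
  proof (rule integral_dominated_convergence)
    show "integrable lborel (\<lambda>x. (\<theta> x)\<^sup>2)" using assms by (simp add: square_integrable_def)
    show "(\<lambda>x. (\<theta> x - \<theta> x * cut k x)\<^sup>2) \<in> borel_measurable lborel" for k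
      using b\<theta> continuous_on_imp_borel[OF cont] by auto
    show "AE x in lborel. (\<lambda>k. (\<theta> x - \<theta> x * cut k x)\<^sup>2) \<longlonglongrightarrow> 0"
    proof (rule AE_I2)
      fix x
      obtain N :: nat where N: "\<bar>x\<bar> < real N" using reals_Archimedean2 by blast
      have "\<forall>\<^sub>F k in sequentially. (\<theta> x - \<theta> x * cut k x)\<^sup>2 = 0"
        using eventually_ge_at_top[of N]
      proof eventually_elim
        case (elim k)
        then have "real N \<le> real k" by simp
        then have "cut k x = 1" using N by (simp add: cut_def)
        then show ?case by simp
      qed
      then show "(\<lambda>k. (\<theta> x - \<theta> x * cut k x)\<^sup>2) \<longlonglongrightarrow> 0" by (rule tendsto_eventually)
    qed
    show "AE x in lborel. norm ((\<theta> x - \<theta> x * cut k x)\<^sup>2) \<le> (\<theta> x)\<^sup>2" for k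
    proof (rule AE_I2)
      fix x
      have "(1 - cut k x)\<^sup>2 \<le> 1" by (rule power_le_one) (auto simp: cut_def)
      then have "(\<theta> x)\<^sup>2 * (1 - cut k x)\<^sup>2 \<le> (\<theta> x)\<^sup>2 * 1" by (intro mult_left_mono) auto
      then show "norm ((\<theta> x - \<theta> x * cut k x)\<^sup>2) \<le> (\<theta> x)\<^sup>2"
        by (simp add: power_mult_distrib[symmetric] right_diff_distrib)
    qed
  qed simp
  then have "\<forall>\<^sub>F k in sequentially. (\<integral>x. (\<theta> x - \<theta> x * cut k x)\<^sup>2 \<partial>lborel) < \<epsilon>"
    using order_tendstoD(2) assms(3) by fastforce
  then obtain k where k: "(\<integral>x. (\<theta> x - \<theta> x * cut k x)\<^sup>2 \<partial>lborel) < \<epsilon>"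
    by (meson eventually_happens' sequentially_bot)
  have "Cc (cut k)" unfolding Cc_def using cont by (auto simp: cut_def intro!: exI[of _ "real k + 1"])
  then show ?thesis using that[OF _ k] assms by (auto intro: Cc_mult_continuous)
qed

text \<open>
  The coefficients of the excluded directions are absorbed into the functions \<open>\<theta> i\<close>, which are
  not normalised.
\<close>

definition codim_bound :: "nat \<Rightarrow> real \<Rightarrow> ((real \<Rightarrow> real) \<Rightarrow> real) \<Rightarrow> bool" where
  "codim_bound m c Q \<longleftrightarrow> (\<forall>\<epsilon>>0. \<exists>\<theta> :: nat \<Rightarrow> real \<Rightarrow> real.
     (\<forall>i<m. continuous_on UNIV (\<theta> i) \<and> square_integrable lborel (\<theta> i)) \<and>
     (\<forall>w. C1c w \<longrightarrow> (c - \<epsilon>) * (\<integral>x. (w x)\<^sup>2 \<partial>lborel) - (\<Sum>i<m. (\<integral>x. w x * \<theta> i x \<partial>lborel)\<^sup>2) \<le> Q w))"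

lemma power2_add_le: "((a::real) + b)\<^sup>2 \<le> 2 * a\<^sup>2 + 2 * b\<^sup>2"
  using zero_le_power2[of "a - b"] by (simp add: power2_eq_square algebra_simps)

text \<open>Half of \<open>\<epsilon>\<close> goes into the given bound and half into replacing each
  \<open>\<theta> i\<close> by a nearby compactly supported \<open>\<eta> i\<close>. By
  Cauchy-Schwarz the error is a small multiple of the squared norm of \<open>w\<close>, so the main
  term absorbs it.\<close>

lemma codim_bound_Cc:
  assumes "codim_bound m c Q" "\<epsilon> > 0"
  obtains \<theta> where "\<And>i. i < m \<Longrightarrow> Cc (\<theta> i)"
    "\<And>w. C1c w \<Longrightarrow> (c - \<epsilon>) * (\<integral>x. (w x)\<^sup>2 \<partial>lborel) - (\<Sum>i<m. (\<integral>x. w x * \<theta> i x \<partial>lborel)\<^sup>2) \<le> Q w"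
proof -
  have "\<epsilon> / 2 > 0" using assms by simp
  then obtain \<theta> where \<theta>: "\<And>i. i < m \<Longrightarrow> continuous_on UNIV (\<theta> i)" "\<And>i. i < m \<Longrightarrow> square_integrable lborel (\<theta> i)"
    and low: "\<And>w. C1c w \<Longrightarrow>
      (c - \<epsilon>/2) * (\<integral>x. (w x)\<^sup>2 \<partial>lborel) - (\<Sum>i<m. (\<integral>x. w x * \<theta> i x \<partial>lborel)\<^sup>2) \<le> Q w"
    using assms(1) unfolding codim_bound_def by blast
  \<comment> \<open>The \<open>m\<close> errors of size \<open>2 \<delta> ?X\<close> must together
    stay below \<open>\<epsilon> / 2 * ?X\<close>; the \<open>+ 1\<close> covers
    \<open>m = 0\<close>.\<close>
  define \<delta> where "\<delta> = \<epsilon> / (4 * (real m + 1))"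
  have "\<delta> > 0" using assms by (simp add: \<delta>_def)
  have "\<forall>i. \<exists>\<eta>. i < m \<longrightarrow> Cc \<eta> \<and> (\<integral>x. (\<theta> i x - \<eta> x)\<^sup>2 \<partial>lborel) < \<delta>"
    using Cc_dense[OF \<theta> \<open>\<delta> > 0\<close>] by metis
  then obtain \<eta> where \<eta>: "\<And>i. i < m \<Longrightarrow> Cc (\<eta> i)"
    "\<And>i. i < m \<Longrightarrow> (\<integral>x. (\<theta> i x - \<eta> i x)\<^sup>2 \<partial>lborel) < \<delta>" by metis
  show ?thesis
  proof (rule that)
    \<comment> \<open>The factor \<open>sqrt 2\<close> absorbs the 2 of
      \<open>(a + b)^2 \<le> 2 a^2 + 2 b^2\<close>.\<close>
    show "Cc (\<lambda>x. sqrt 2 * \<eta> i x)" if "i < m" for i using \<eta>(1)[OF that] by (rule Cc_cmult)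
    fix w assume w: "C1c w"
    let ?X = "\<integral>x. (w x)\<^sup>2 \<partial>lborel"
    have sw: "square_integrable lborel w" using w C1c_Cc Cc_square_integrable by blast
    have "(\<integral>x. w x * \<theta> i x \<partial>lborel)\<^sup>2 \<le> (\<integral>x. w x * (sqrt 2 * \<eta> i x) \<partial>lborel)\<^sup>2 + 2 * \<delta> * ?X" if "i < m" for i
    proof -
      note s\<eta> = Cc_square_integrable[OF \<eta>(1)[OF that]]
      note sd = square_integrable_diff[OF \<theta>(2)[OF that] s\<eta>]
      have "(\<integral>x. w x * \<theta> i x \<partial>lborel) = (\<integral>x. w x * \<eta> i x + w x * (\<theta> i x - \<eta> i x) \<partial>lborel)"
        by (simp add: algebra_simps)
      also have "\<dots> = (\<integral>x. w x * \<eta> i x \<partial>lborel) + (\<integral>x. w x * (\<theta> i x - \<eta> i x) \<partial>lborel)"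
        by (intro Bochner_Integration.integral_add square_integrable_mult sw s\<eta> sd)
      finally have "(\<integral>x. w x * \<theta> i x \<partial>lborel)\<^sup>2
          \<le> 2 * (\<integral>x. w x * \<eta> i x \<partial>lborel)\<^sup>2 + 2 * (\<integral>x. w x * (\<theta> i x - \<eta> i x) \<partial>lborel)\<^sup>2"
        by (simp add: power2_add_le)
      moreover have "(\<integral>x. w x * (\<theta> i x - \<eta> i x) \<partial>lborel)\<^sup>2 \<le> ?X * (\<integral>x. (\<theta> i x - \<eta> i x)\<^sup>2 \<partial>lborel)"
        by (rule integral_Cauchy_Schwarz[OF sw sd])
      moreover have "\<dots> \<le> ?X * \<delta>" using \<eta>(2)[OF that] by (intro mult_left_mono) auto
      moreover have "(\<integral>x. w x * (sqrt 2 * \<eta> i x) \<partial>lborel)\<^sup>2 = 2 * (\<integral>x. w x * \<eta> i x \<partial>lborel)\<^sup>2"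
        by (simp add: mult.left_commute[of _ "sqrt 2"] power_mult_distrib)
      ultimately show ?thesis by (simp add: mult_ac)
    qed
    then have "(\<Sum>i<m. (\<integral>x. w x * \<theta> i x \<partial>lborel)\<^sup>2)
        \<le> (\<Sum>i<m. (\<integral>x. w x * (sqrt 2 * \<eta> i x) \<partial>lborel)\<^sup>2 + 2 * \<delta> * ?X)" by (intro sum_mono) auto
    also have "\<dots> = (\<Sum>i<m. (\<integral>x. w x * (sqrt 2 * \<eta> i x) \<partial>lborel)\<^sup>2) + (2 * real m * \<delta>) * ?X"
      by (simp add: sum.distrib)
    also have "(2 * real m * \<delta>) * ?X \<le> \<epsilon> / 2 * ?X"
      using assms by (intro mult_right_mono) (auto simp: \<delta>_def field_simps)
    finally show "(c - \<epsilon>) * ?X - (\<Sum>i<m. (\<integral>x. w x * (sqrt 2 * \<eta> i x) \<partial>lborel)\<^sup>2) \<le> Q w"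
      using low[OF w] by (simp add: algebra_simps)
  qed
qed

section \<open>Supersymmetric pairs of first-order operators\<close>

text \<open>The operator \<open>A\<close>, given through the derivative of \<open>W\<close>; it
  annihilates \<open>exp (- W)\<close>. Its formal adjoint \<open>A*\<close> is
  \<open>raising\<close>.\<close>

definition lowering :: "(real \<Rightarrow> real) \<Rightarrow> (real \<Rightarrow> real) \<Rightarrow> real \<Rightarrow> real" where
  "lowering W' w x = deriv w x + W' x * w x"

definition raising :: "(real \<Rightarrow> real) \<Rightarrow> (real \<Rightarrow> real) \<Rightarrow> real \<Rightarrow> real" where
  "raising W' w x = W' x * w x - deriv w x"

lemma Cc_lowering: "C1c w \<Longrightarrow> continuous_on UNIV W' \<Longrightarrow> Cc (lowering W' w)"
  unfolding lowering_def C1c_def by (auto intro!: Cc_intros)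

lemma lowering_adjoint:
  assumes w: "C1c w" and v: "C1c v" and W': "continuous_on UNIV W'"
  shows "(\<integral>x. w x * raising W' v x \<partial>lborel) = (\<integral>x. lowering W' w x * v x \<partial>lborel)"
proof -
  have 1: "(\<integral>x. deriv w x * v x \<partial>lborel) = - (\<integral>x. w x * deriv v x \<partial>lborel)"
    using w v by (intro integral_by_parts_C1c) (auto simp: C1c_def Cc_def)
  have i: "integrable lborel (\<lambda>x. deriv w x * v x)" "integrable lborel (\<lambda>x. w x * deriv v x)"
    "integrable lborel (\<lambda>x. W' x * (w x * v x))"
    using w v W' by (auto simp: C1c_def intro!: Cc_integrable Cc_intros intro: Cc_continuous)
  have "(\<integral>x. w x * raising W' v x \<partial>lborel) = (\<integral>x. W' x * (w x * v x) - w x * deriv v x \<partial>lborel)"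
    by (simp add: raising_def algebra_simps)
  also have "\<dots> = (\<integral>x. deriv w x * v x + W' x * (w x * v x) \<partial>lborel)" using i 1 by simp
  finally show ?thesis by (simp add: lowering_def algebra_simps)
qed

text \<open>Expanding the squares leaves the cross term \<open>2 W' w w' = W' (w^2)'\<close>, with
  opposite signs in the two cases, and integration by parts turns it into \<open>- W'' w^2\<close>.
  So the partners \<open>A* A\<close> and \<open>A A*\<close> differ only in the sign of
  \<open>W''\<close> in their potentials.\<close>

lemma
  assumes w: "C1c w" and d: "\<And>x. (W' has_real_derivative W'' x) (at x)" and W'': "continuous_on UNIV W''"
  shows integral_lowering_sq: "(\<integral>x. (lowering W' w x)\<^sup>2 \<partial>lborel)
      = (\<integral>x. (deriv w x)\<^sup>2 \<partial>lborel) + (\<integral>x. ((W' x)\<^sup>2 - W'' x) * (w x)\<^sup>2 \<partial>lborel)"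
    and integral_raising_sq: "(\<integral>x. (raising W' w x)\<^sup>2 \<partial>lborel)
      = (\<integral>x. (deriv w x)\<^sup>2 \<partial>lborel) + (\<integral>x. ((W' x)\<^sup>2 + W'' x) * (w x)\<^sup>2 \<partial>lborel)"
proof -
  have W': "continuous_on UNIV W'"
    using d by (meson DERIV_isCont continuous_at_imp_continuous_on)
  have dw: "(w has_real_derivative deriv w x) (at x)" for x using w by (simp add: C1c_def)
  have Cw: "Cc w" "Cc (deriv w)" using w by (auto simp: C1c_def)
  have w2: "C1c (\<lambda>x. w x * w x)" "deriv (\<lambda>x. w x * w x) = (\<lambda>x. deriv w x * w x + w x * deriv w x)"
    using C1c_mult[OF w dw] Cw by (auto simp: Cc_def)
  have parts: "(\<integral>x. 2 * (W' x * (w x * deriv w x)) \<partial>lborel) = - (\<integral>x. W'' x * (w x)\<^sup>2 \<partial>lborel)"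
    using integral_by_parts_C1c[OF w2(1) d W''] unfolding w2(2) by (simp add: algebra_simps power2_eq_square)
  have i: "integrable lborel (\<lambda>x. (deriv w x)\<^sup>2)" "integrable lborel (\<lambda>x. (W' x)\<^sup>2 * (w x)\<^sup>2)"
    "integrable lborel (\<lambda>x. W'' x * (w x)\<^sup>2)" "integrable lborel (\<lambda>x. 2 * (W' x * (w x * deriv w x)))"
    using Cw W' W'' by (auto intro!: Cc_integrable Cc_intros continuous_intros intro: Cc_continuous)
  have "(\<integral>x. (lowering W' w x)\<^sup>2 \<partial>lborel)
      = (\<integral>x. (deriv w x)\<^sup>2 + (W' x)\<^sup>2 * (w x)\<^sup>2 + 2 * (W' x * (w x * deriv w x)) \<partial>lborel)"
    by (intro Bochner_Integration.integral_cong) (auto simp: lowering_def power2_eq_square algebra_simps)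
  also have "\<dots> = (\<integral>x. (deriv w x)\<^sup>2 \<partial>lborel) + (\<integral>x. ((W' x)\<^sup>2 - W'' x) * (w x)\<^sup>2 \<partial>lborel)"
    using i parts by (simp add: left_diff_distrib del: integral_mult_right_zero)
  finally show "(\<integral>x. (lowering W' w x)\<^sup>2 \<partial>lborel)
      = (\<integral>x. (deriv w x)\<^sup>2 \<partial>lborel) + (\<integral>x. ((W' x)\<^sup>2 - W'' x) * (w x)\<^sup>2 \<partial>lborel)" .
  have "(\<integral>x. (raising W' w x)\<^sup>2 \<partial>lborel)
      = (\<integral>x. (deriv w x)\<^sup>2 + (W' x)\<^sup>2 * (w x)\<^sup>2 - 2 * (W' x * (w x * deriv w x)) \<partial>lborel)"
    by (intro Bochner_Integration.integral_cong) (auto simp: raising_def power2_eq_square algebra_simps)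
  also have "\<dots> = (\<integral>x. (deriv w x)\<^sup>2 \<partial>lborel) + (\<integral>x. ((W' x)\<^sup>2 + W'' x) * (w x)\<^sup>2 \<partial>lborel)"
    using i parts by (simp add: distrib_right del: integral_mult_right_zero)
  finally show "(\<integral>x. (raising W' w x)\<^sup>2 \<partial>lborel)
      = (\<integral>x. (deriv w x)\<^sup>2 \<partial>lborel) + (\<integral>x. ((W' x)\<^sup>2 + W'' x) * (w x)\<^sup>2 \<partial>lborel)" .
qed

text \<open>A bump normalised against \<open>g\<close>. Subtracting a multiple of it makes a
  function orthogonal to \<open>exp (- W)\<close> without leaving \<open>C1c\<close>.\<close>

lemma C1c_unit_mass:
  assumes "continuous_on UNIV g" "\<And>x. g x > 0"
  obtains p where "C1c p" "(\<integral>x. p x * g x \<partial>lborel) = 1"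
proof -
  \<comment> \<open>Squaring the truncated parabola makes the derivative continuous at the edges 1
    and -1.\<close>
  define b where "b x = (max 0 (1 - x\<^sup>2))\<^sup>2" for x :: real
  define b' where "b' x = - 4 * x * max 0 (1 - x\<^sup>2)" for x :: real
  have "(b has_real_derivative b' x) (at x)" for x
  proof -
    consider "x\<^sup>2 < 1" | "x\<^sup>2 > 1" | "x\<^sup>2 = 1" by linarith
    then show ?thesis
    proof cases
      case 1
      have "eventually (\<lambda>y. y\<^sup>2 < 1) (nhds x)"
        by (rule order_tendstoD(2)[OF _ 1]) (intro tendsto_power filterlim_ident)
      then have "eventually (\<lambda>y. b y = (1 - y\<^sup>2)\<^sup>2) (nhds x)" by eventually_elim (simp add: b_def)
      moreover have "((\<lambda>y. (1 - y\<^sup>2)\<^sup>2) has_real_derivative b' x) (at x)"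
        using 1 by (auto intro!: derivative_eq_intros simp: b'_def)
      ultimately show ?thesis by (subst DERIV_cong_ev[OF refl _ refl])
    next
      case 2
      have "eventually (\<lambda>y. y\<^sup>2 > 1) (nhds x)"
        by (rule order_tendstoD(1)[OF _ 2]) (intro tendsto_power filterlim_ident)
      then have "eventually (\<lambda>y. b y = 0) (nhds x)" by eventually_elim (simp add: b_def)
      moreover have "((\<lambda>y. 0) has_real_derivative b' x) (at x)"
        using 2 by (simp add: b'_def)
      ultimately show ?thesis by (subst DERIV_cong_ev[OF refl _ refl])
    next
      case 3
      \<comment> \<open>At an edge \<open>b x = 0\<close>, and
        \<open>1 - y^2 = (x + y) (x - y)\<close> because \<open>x^2 = 1\<close>; hence the
        difference quotient is at most the absolute value of this expression.\<close>
      have lim: "((\<lambda>y. (1 - y\<^sup>2) * (x + y)) \<longlongrightarrow> 0) (at x)"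
        using 3 by (auto intro!: tendsto_eq_intros)
      have "((\<lambda>y. (b y - b x) / (y - x)) \<longlongrightarrow> 0) (at x)"
      proof (rule Lim_null_comparison[OF _ tendsto_rabs_zero[OF lim]])
        have "norm ((b y - b x) / (y - x)) \<le> \<bar>(1 - y\<^sup>2) * (x + y)\<bar>" if "y \<noteq> x" for y
        proof -
          have "\<bar>b y\<bar> \<le> (1 - y\<^sup>2)\<^sup>2" unfolding b_def by (auto simp: max_def)
          also have "\<dots> = \<bar>(1 - y\<^sup>2) * (x + y)\<bar> * \<bar>y - x\<bar>"
          proof -
            have "(1 - y\<^sup>2)\<^sup>2 = \<bar>(1 - y\<^sup>2) * (1 - y\<^sup>2)\<bar>" by (simp add: power2_eq_square)
            also have "\<dots> = \<bar>(1 - y\<^sup>2) * ((x + y) * (x - y))\<bar>"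
              using 3 by (simp add: power2_eq_square algebra_simps)
            finally show ?thesis by (simp add: abs_mult mult.assoc abs_minus_commute)
          qed
          finally show ?thesis using that 3 by (simp add: b_def divide_le_eq)
        qed
        then show "\<forall>\<^sub>F y in at x. norm ((b y - b x) / (y - x)) \<le> \<bar>(1 - y\<^sup>2) * (x + y)\<bar>"
          by (auto simp: eventually_at_filter)
      qed
      then show ?thesis using 3 by (simp add: has_field_derivative_iff b'_def)
    qed
  qed
  moreover have "continuous_on UNIV b'" unfolding b'_def by (intro continuous_intros)
  moreover have "b x = 0" if "1 < \<bar>x\<bar>" for x
    using that by (simp add: b_def max_def power2_le_iff_abs_le abs_square_le_1)
  ultimately have b: "C1c b" using C1cI(1)[of b b' 1] by blast
  have Cbg: "Cc (\<lambda>x. b x * g x)" using C1c_Cc[OF b] assms by (intro Cc_mult_continuous)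
  define I where "I = (\<integral>x. b x * g x \<partial>lborel)"
  \<comment> \<open>The integrand is nonnegative, and positive between -1 and 1; a zero integral
    would make that interval a null set.\<close>
  have "I \<noteq> 0"
  proof
    assume "I = 0"
    have "AE x in lborel. b x * g x = 0"
      using \<open>I = 0\<close> integral_nonneg_eq_0_iff_AE[OF Cc_integrable[OF Cbg]] assms(2)
      by (simp add: I_def b_def less_imp_le)
    then have "AE x in lborel. x \<notin> {-1<..<1::real}"
    proof eventually_elim
      case (elim x)
      then have "b x = 0" using assms(2)[of x] by simp
      then have "1 \<le> x\<^sup>2" by (simp add: b_def max_def split: if_splits)
      then show ?case using abs_square_less_1[of x] by auto
    qed
    then have "{-1<..<1::real} \<in> null_sets lborel" by (subst AE_iff_null_sets) auto
    then show False by (simp add: null_sets_def)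
  qed
  have "C1c (\<lambda>x. b x * (1 / I))" by (rule C1c_mult(1)[OF b, where g' = "\<lambda>x. 0"]) auto
  moreover have "(\<integral>x. b x * (1 / I) * g x \<partial>lborel) = 1"
  proof -
    have "(\<integral>x. b x * (1 / I) * g x \<partial>lborel) = (\<integral>x. (1 / I) * (b x * g x) \<partial>lborel)" by (simp add: mult_ac)
    then show ?thesis using \<open>I \<noteq> 0\<close> by (simp add: I_def)
  qed
  ultimately show ?thesis by (rule that)
qed

text \<open>The equation \<open>A* v = w\<close> reads
  \<open>- (v exp (- W))' = w exp (- W)\<close>; the orthogonality of \<open>w\<close> to
  \<open>exp (- W)\<close> gives it a compactly supported solution. The last clause, again by parts,
  turns the pairing of \<open>v\<close> with \<open>\<theta>\<close> into a pairing of
  \<open>w\<close> with a function that does not depend on \<open>w\<close>.\<close>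

lemma raising_preimage:
  assumes dW: "\<And>x. (W has_real_derivative W' x) (at x)" and W': "continuous_on UNIV W'"
    and w: "Cc w" "(\<integral>x. w x * exp (- W x) \<partial>lborel) = 0"
  obtains v where "C1c v" "raising W' v = w"
    "\<And>\<theta> G. continuous_on UNIV \<theta> \<Longrightarrow> (\<And>x. (G has_real_derivative \<theta> x * exp (W x)) (at x)) \<Longrightarrow>
      (\<integral>x. v x * \<theta> x \<partial>lborel) = (\<integral>x. w x * (exp (- W x) * G x) \<partial>lborel)"
proof -
  have W: "continuous_on UNIV W" using dW by (meson DERIV_isCont continuous_at_imp_continuous_on)
  have "Cc (\<lambda>x. w x * exp (- W x))" using w(1) W by (intro Cc_mult_continuous continuous_intros) auto
  then obtain F where F: "C1c F" "deriv F = (\<lambda>x. w x * exp (- W x))"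
    using Cc_antiderivative_C1c w(2) by blast
  have dE: "((\<lambda>x. - exp (W x)) has_real_derivative - (exp (W x) * W' x)) (at x)" for x
    using dW[of x] by (auto intro!: derivative_eq_intros)
  have cE: "continuous_on UNIV (\<lambda>x. - (exp (W x) * W' x))" using W W' by (intro continuous_intros)
  note v = C1c_mult[OF F(1) dE cE]
  show ?thesis
  proof (rule that[OF v(1)])
    show "raising W' (\<lambda>x. F x * - exp (W x)) = w"
      unfolding raising_def v(2) F(2) by (auto simp: exp_minus field_simps)
    fix \<theta> G assume \<theta>: "continuous_on UNIV \<theta>" and G: "\<And>x. (G has_real_derivative \<theta> x * exp (W x)) (at x)"
    have "(\<integral>x. F x * - exp (W x) * \<theta> x \<partial>lborel) = - (\<integral>x. F x * (\<theta> x * exp (W x)) \<partial>lborel)"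
      by (simp add: mult_ac)
    also have "\<dots> = (\<integral>x. deriv F x * G x \<partial>lborel)"
      by (subst integral_by_parts_C1c[OF F(1) G]) (use \<theta> W in \<open>auto intro!: continuous_intros\<close>)
    finally show "(\<integral>x. F x * - exp (W x) * \<theta> x \<partial>lborel) = (\<integral>x. w x * (exp (- W x) * G x) \<partial>lborel)"
      by (simp add: F(2) mult_ac)
  qed
qed

section \<open>Transfer of a bound from \<open>A A*\<close> to \<open>A* A\<close> at the cost of
  one direction\<close>

lemma sq_diff_le:
  fixes a b \<delta> :: real assumes "\<delta> > 0"
  shows "(a - b)\<^sup>2 \<le> (1 + \<delta>) * a\<^sup>2 + (1 + 1 / \<delta>) * b\<^sup>2" "(a - b)\<^sup>2 \<ge> (1 - \<delta>) * a\<^sup>2 - (1 / \<delta>) * b\<^sup>2"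
proof -
  \<comment> \<open>Young's inequality; a small \<open>\<delta>\<close> keeps the coefficient of
    \<open>a^2\<close> close to 1 at the price of a large one for \<open>b^2\<close>.\<close>
  have *: "2 * \<bar>a * b\<bar> \<le> \<delta> * a\<^sup>2 + (1 / \<delta>) * b\<^sup>2"
  proof -
    have "0 \<le> (\<delta> * \<bar>a\<bar> - \<bar>b\<bar>)\<^sup>2 / \<delta>" using assms by simp
    also have "\<dots> = \<delta> * a\<^sup>2 + (1 / \<delta>) * b\<^sup>2 - 2 * \<bar>a * b\<bar>"
      using assms by (simp add: power2_eq_square abs_mult field_simps)
    finally show ?thesis by simp
  qed
  have "2 * (a * b) \<le> 2 * \<bar>a * b\<bar>" "- (2 * (a * b)) \<le> 2 * \<bar>a * b\<bar>" by linarith+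
  moreover have "(a - b)\<^sup>2 = a\<^sup>2 + b\<^sup>2 - 2 * (a * b)" by (simp add: power2_eq_square algebra_simps)
  moreover have "b\<^sup>2 \<ge> 0" by simp
  ultimately show "(a - b)\<^sup>2 \<le> (1 + \<delta>) * a\<^sup>2 + (1 + 1 / \<delta>) * b\<^sup>2" "(a - b)\<^sup>2 \<ge> (1 - \<delta>) * a\<^sup>2 - (1 / \<delta>) * b\<^sup>2"
    using * by (simp_all only: distrib_right left_diff_distrib mult_1_left)
qed

lemma integral_sq_diff_le:
  fixes f g :: "'a \<Rightarrow> real"
  assumes "\<delta> > 0" "square_integrable M f" "square_integrable M g"
  shows "(\<integral>x. (f x - g x)\<^sup>2 \<partial>M) \<le> (1 + \<delta>) * (\<integral>x. (f x)\<^sup>2 \<partial>M) + (1 + 1 / \<delta>) * (\<integral>x. (g x)\<^sup>2 \<partial>M)"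
    and "(\<integral>x. (f x - g x)\<^sup>2 \<partial>M) \<ge> (1 - \<delta>) * (\<integral>x. (f x)\<^sup>2 \<partial>M) - (1 / \<delta>) * (\<integral>x. (g x)\<^sup>2 \<partial>M)"
proof -
  have i: "integrable M (\<lambda>x. (f x)\<^sup>2)" "integrable M (\<lambda>x. (g x)\<^sup>2)" "integrable M (\<lambda>x. (f x - g x)\<^sup>2)"
    using assms square_integrable_diff[OF assms(2,3)] by (auto simp: square_integrable_def)
  have "(\<integral>x. (f x - g x)\<^sup>2 \<partial>M) \<le> (\<integral>x. (1 + \<delta>) * (f x)\<^sup>2 + (1 + 1 / \<delta>) * (g x)\<^sup>2 \<partial>M)"
    using i sq_diff_le[OF assms(1)] by (intro integral_mono) auto
  then show "(\<integral>x. (f x - g x)\<^sup>2 \<partial>M) \<le> (1 + \<delta>) * (\<integral>x. (f x)\<^sup>2 \<partial>M) + (1 + 1 / \<delta>) * (\<integral>x. (g x)\<^sup>2 \<partial>M)"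
    using i by simp
  have "(\<integral>x. (1 - \<delta>) * (f x)\<^sup>2 - (1 / \<delta>) * (g x)\<^sup>2 \<partial>M) \<le> (\<integral>x. (f x - g x)\<^sup>2 \<partial>M)"
    using i sq_diff_le[OF assms(1)] by (intro integral_mono) auto
  then show "(\<integral>x. (f x - g x)\<^sup>2 \<partial>M) \<ge> (1 - \<delta>) * (\<integral>x. (f x)\<^sup>2 \<partial>M) - (1 / \<delta>) * (\<integral>x. (g x)\<^sup>2 \<partial>M)"
    using i by simp
qed

text \<open>The directions for \<open>v\<close> become directions for \<open>w\<close> through
  \<open>raising_preimage\<close>, and \<open>exp (- W)\<close> is the extra one. The bound is first
  shown for \<open>w\<close> orthogonal to \<open>exp (- W)\<close>; a general \<open>w\<close> is
  then corrected by a multiple of a fixed bump, and the error becomes the penalty along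
  \<open>exp (- W)\<close>.\<close>

lemma codim_bound_Suc:
  assumes dW: "\<And>x. (W has_real_derivative W' x) (at x)" and W': "continuous_on UNIV W'"
    and int: "integrable lborel (\<lambda>x. exp (- (2 * W x)))"
    and bound: "codim_bound m c (\<lambda>v. \<integral>x. (raising W' v x)\<^sup>2 \<partial>lborel)"
  shows "codim_bound (Suc m) c (\<lambda>w. \<integral>x. (lowering W' w x)\<^sup>2 \<partial>lborel)"
  unfolding codim_bound_def
proof (intro allI impI)
  fix \<epsilon> :: real assume "\<epsilon> > 0"
  \<comment> \<open>One half of \<open>\<epsilon>\<close> pays for compactly supported directions,
    the other for the correction along \<open>exp (- W)\<close>.\<close>
  define c1 where "c1 = c - \<epsilon> / 2"
  have W: "continuous_on UNIV W" using dW by (meson DERIV_isCont continuous_at_imp_continuous_on)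
  show "\<exists>\<theta>. (\<forall>i<Suc m. continuous_on UNIV (\<theta> i) \<and> square_integrable lborel (\<theta> i)) \<and>
     (\<forall>w. C1c w \<longrightarrow> (c - \<epsilon>) * (\<integral>x. (w x)\<^sup>2 \<partial>lborel) - (\<Sum>i<Suc m. (\<integral>x. w x * \<theta> i x \<partial>lborel)\<^sup>2)
        \<le> (\<integral>x. (lowering W' w x)\<^sup>2 \<partial>lborel))"
  proof (cases "c1 \<le> 0")
    \<comment> \<open>The left side is nonpositive here, so zero directions serve.\<close>
    case True
    then have "c - \<epsilon> \<le> 0" using \<open>\<epsilon> > 0\<close> by (simp add: c1_def)
    then have "(c - \<epsilon>) * (\<integral>x. (w x)\<^sup>2 \<partial>lborel) \<le> 0" for w :: "real \<Rightarrow> real"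
      by (intro mult_nonpos_nonneg) auto
    moreover have "0 \<le> (\<integral>x. (lowering W' w x)\<^sup>2 \<partial>lborel)" for w by simp
    ultimately have "(c - \<epsilon>) * (\<integral>x. (w x)\<^sup>2 \<partial>lborel) \<le> (\<integral>x. (lowering W' w x)\<^sup>2 \<partial>lborel)" for w
      using order_trans by blast
    then show ?thesis by (intro exI[of _ "\<lambda>_ _. 0"]) (simp add: square_integrable_def)
  next
    case False
    then have "c1 > 0" by simp
    obtain \<theta> where \<theta>: "\<And>i. i < m \<Longrightarrow> Cc (\<theta> i)"
      and low: "\<And>v. C1c v \<Longrightarrow> c1 * (\<integral>x. (v x)\<^sup>2 \<partial>lborel) - (\<Sum>i<m. (\<integral>x. v x * \<theta> i x \<partial>lborel)\<^sup>2)
         \<le> (\<integral>x. (raising W' v x)\<^sup>2 \<partial>lborel)"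
      using codim_bound_Cc[OF bound, of "\<epsilon> / 2"] \<open>\<epsilon> > 0\<close> unfolding c1_def by auto
    have "\<forall>i. \<exists>G. i < m \<longrightarrow> (\<forall>x. (G has_real_derivative \<theta> i x * exp (W x)) (at x))"
    proof
      fix i
      show "\<exists>G. i < m \<longrightarrow> (\<forall>x. (G has_real_derivative \<theta> i x * exp (W x)) (at x))"
      proof (cases "i < m")
        case True
        have "continuous_on UNIV (\<lambda>x. \<theta> i x * exp (W x))"
          using Cc_continuous[OF \<theta>[OF True]] W by (intro continuous_intros)
        then show ?thesis by (rule continuous_antiderivative) blast
      qed simp
    qed
    then obtain G where G: "\<And>i x. i < m \<Longrightarrow> (G i has_real_derivative \<theta> i x * exp (W x)) (at x)" by metis
    define e where "e x = exp (- W x)" for x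
    \<comment> \<open>Chosen so that the pairing of \<open>w\<close> with \<open>\<eta> i\<close>
      equals that of \<open>v\<close> with \<open>\<theta> i\<close> whenever \<open>v\<close> is
      the preimage of \<open>w\<close>.\<close>
    define \<eta> where "\<eta> i x = e x * G i x" for i x
    have ce: "continuous_on UNIV e" unfolding e_def using W by (intro continuous_intros)
    have se: "square_integrable lborel e"
      using int continuous_on_imp_borel[OF ce] by (simp add: square_integrable_def e_def flip: exp_of_nat_mult)
    have c\<eta>: "continuous_on UNIV (\<eta> i)" if "i < m" for i
      unfolding \<eta>_def using ce G[OF that]
      by (intro continuous_on_mult) (auto intro: DERIV_isCont continuous_at_imp_continuous_on)
    \<comment> \<open>Compact support of \<open>\<theta> i\<close> bounds \<open>G i\<close>, so
      \<open>\<eta> i\<close> is dominated by a multiple of \<open>e\<close>, which is square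
      integrable by \<open>int\<close>.\<close>
    have s\<eta>: "square_integrable lborel (\<eta> i)" if "i < m" for i
    proof -
      have "Cc (\<lambda>x. \<theta> i x * exp (W x))" using \<theta>[OF that] W by (intro Cc_mult_continuous continuous_intros) auto
      from Cc_antiderivative_bounded[OF this G[OF that]] obtain B where B: "\<And>x. \<bar>G i x\<bar> \<le> B" by blast
      have "integrable lborel (\<lambda>x. (\<eta> i x)\<^sup>2)"
      proof (rule Bochner_Integration.integrable_bound)
        show "integrable lborel (\<lambda>x. B\<^sup>2 * (e x)\<^sup>2)" using se by (simp add: square_integrable_def)
        show "(\<lambda>x. (\<eta> i x)\<^sup>2) \<in> borel_measurable lborel"
          using continuous_on_imp_borel[OF c\<eta>[OF that]] by simp
        have "(G i x)\<^sup>2 \<le> B\<^sup>2" for x using B[of x] by (metis abs_ge_zero power2_abs power_mono)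
        then show "AE x in lborel. norm ((\<eta> i x)\<^sup>2) \<le> norm (B\<^sup>2 * (e x)\<^sup>2)"
          by (intro AE_I2) (simp add: \<eta>_def power_mult_distrib mult.commute[of "B\<^sup>2"] mult_left_mono)
      qed
      then show ?thesis using continuous_on_imp_borel[OF c\<eta>[OF that]] by (simp add: square_integrable_def)
    qed
    obtain p where p: "C1c p" "(\<integral>x. p x * e x \<partial>lborel) = 1"
      using C1c_unit_mass[OF ce] by (auto simp: e_def)
    \<comment> \<open>For the preimage \<open>v\<close> with squared norm \<open>?N\<close>, the
      assumed bound gives \<open>c1 * ?N \<le> ?X + ?D\<close>, and duality with Cauchy-Schwarz
      gives \<open>?X^2 \<le> ?Y * ?N\<close>. Eliminating \<open>?N\<close> leaves an inequality in
      \<open>w\<close> alone.\<close>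
    have core: "c1 * (\<integral>x. (w x)\<^sup>2 \<partial>lborel) - c1 * (\<Sum>i<m. (\<integral>x. w x * \<eta> i x \<partial>lborel)\<^sup>2)
         \<le> (\<integral>x. (lowering W' w x)\<^sup>2 \<partial>lborel)" (is "c1 * ?X - c1 * ?D \<le> ?Y")
      if w: "C1c w" "(\<integral>x. w x * e x \<partial>lborel) = 0" for w
    proof -
      obtain v where v: "C1c v" "raising W' v = w"
        and vG: "\<And>\<theta> G. continuous_on UNIV \<theta> \<Longrightarrow> (\<And>x. (G has_real_derivative \<theta> x * exp (W x)) (at x)) \<Longrightarrow>
          (\<integral>x. v x * \<theta> x \<partial>lborel) = (\<integral>x. w x * (exp (- W x) * G x) \<partial>lborel)"
        using raising_preimage[OF dW W' C1c_Cc[OF w(1)]] w(2) unfolding e_def by blast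
      let ?N = "\<integral>x. (v x)\<^sup>2 \<partial>lborel"
      have "(\<integral>x. v x * \<theta> i x \<partial>lborel) = (\<integral>x. w x * \<eta> i x \<partial>lborel)" if "i < m" for i
        unfolding \<eta>_def e_def using Cc_continuous[OF \<theta>[OF that]] G[OF that] by (rule vG)
      then have 1: "c1 * ?N \<le> ?X + ?D" using low[OF v(1)] v(2) by simp
      have "?X = (\<integral>x. w x * raising W' v x \<partial>lborel)" by (simp add: v(2) power2_eq_square)
      also have "\<dots> = (\<integral>x. lowering W' w x * v x \<partial>lborel)" by (rule lowering_adjoint[OF w(1) v(1) W'])
      finally have "?X\<^sup>2 \<le> ?Y * ?N"
        using integral_Cauchy_Schwarz[OF Cc_square_integrable[OF Cc_lowering[OF w(1) W']] Cc_square_integrable[OF C1c_Cc[OF v(1)]]]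
        by simp
      then have "c1 * ?X\<^sup>2 \<le> ?Y * (c1 * ?N)" using \<open>c1 > 0\<close> by (simp add: mult.left_commute)
      also have "\<dots> \<le> ?Y * (?X + ?D)" using 1 by (intro mult_left_mono) auto
      finally have 2: "c1 * ?X\<^sup>2 \<le> ?Y * (?X + ?D)" .
      have nn: "?X \<ge> 0" "?D \<ge> 0" "?Y \<ge> 0" by (auto intro: sum_nonneg)
      show ?thesis
      proof (cases "?X + ?D = 0")
        case True
        then have "?X = 0" "?D = 0" using nn by linarith+
        then show ?thesis using nn by simp
      next
        case False
        then have pos: "?X + ?D > 0" using nn by linarith
        \<comment> \<open>As \<open>(?X - ?D) (?X + ?D) \<le> ?X^2\<close>, the quadratic inequality
          becomes linear after division by \<open>?X + ?D\<close>.\<close>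
        have "(c1 * ?X - c1 * ?D) * (?X + ?D) = c1 * ?X\<^sup>2 - c1 * ?D\<^sup>2"
          by (simp add: power2_eq_square algebra_simps)
        also have "\<dots> \<le> c1 * ?X\<^sup>2" using \<open>c1 > 0\<close> by simp
        also note 2
        finally show ?thesis using pos by (simp add: mult_le_cancel_right)
      qed
    qed
    \<comment> \<open>This gives \<open>c1 \<delta> = \<epsilon> / 4\<close>, so
      \<open>c1 (1 - \<delta>)\<close> still exceeds \<open>(1 + \<delta>) (c - \<epsilon>)\<close>,
      by exactly \<open>\<delta> \<epsilon> / 2\<close>.\<close>
    define \<delta> where "\<delta> = \<epsilon> / (4 * c1)"
    have "\<delta> > 0" using \<open>\<epsilon> > 0\<close> \<open>c1 > 0\<close> by (simp add: \<delta>_def)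
    \<comment> \<open>Collects the coefficients of \<open>s^2\<close> that arise from replacing
      \<open>w\<close> by \<open>w - s p\<close>: in the norm, in the penalties and in the
      energy.\<close>
    define K where "K = c1 / \<delta> * (\<integral>x. (p x)\<^sup>2 \<partial>lborel) + 2 * c1 * (\<Sum>i<m. (\<integral>x. p x * \<eta> i x \<partial>lborel)\<^sup>2)
      + (1 + 1 / \<delta>) * (\<integral>x. (lowering W' p x)\<^sup>2 \<partial>lborel)"
    have "K \<ge> 0" unfolding K_def using \<open>\<delta> > 0\<close> \<open>c1 > 0\<close>
      by (intro add_nonneg_nonneg mult_nonneg_nonneg sum_nonneg) auto
    have est: "(c - \<epsilon>) * (\<integral>x. (w x)\<^sup>2 \<partial>lborel)
        - (2 * c1 * (\<Sum>i<m. (\<integral>x. w x * \<eta> i x \<partial>lborel)\<^sup>2) + K * (\<integral>x. w x * e x \<partial>lborel)\<^sup>2)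
        \<le> (\<integral>x. (lowering W' w x)\<^sup>2 \<partial>lborel)" if w: "C1c w" for w
    proof -
      define s where "s = (\<integral>x. w x * e x \<partial>lborel)"
      \<comment> \<open>Since \<open>p\<close> has pairing 1 with \<open>e\<close>, this
        \<open>u\<close> is orthogonal to \<open>e\<close>.\<close>
      define u where "u x = w x - s * p x" for x
      have u: "C1c u" and du: "deriv u = (\<lambda>x. deriv w x - s * deriv p x)"
        using C1c_diff_cmult[OF w p(1), of s] unfolding u_def by auto
      have sw: "square_integrable lborel w" and sp: "square_integrable lborel p"
        and sLw: "square_integrable lborel (lowering W' w)" and sLp: "square_integrable lborel (lowering W' p)"
        using w p W' by (auto intro: Cc_square_integrable[OF C1c_Cc] Cc_square_integrable[OF Cc_lowering])
      have lin: "(\<integral>x. u x * h x \<partial>lborel) = (\<integral>x. w x * h x \<partial>lborel) - s * (\<integral>x. p x * h x \<partial>lborel)"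
        if "square_integrable lborel h" for h
      proof -
        have "(\<integral>x. u x * h x \<partial>lborel) = (\<integral>x. w x * h x - s * (p x * h x) \<partial>lborel)"
          by (simp add: u_def algebra_simps)
        then show ?thesis
          using square_integrable_mult[OF sw that] square_integrable_mult[OF sp that] by simp
      qed
      have "(\<integral>x. u x * e x \<partial>lborel) = 0" using lin[OF se] p(2) by (simp add: s_def)
      note core = core[OF u this]
      have X: "(\<integral>x. (u x)\<^sup>2 \<partial>lborel) \<ge> (1 - \<delta>) * (\<integral>x. (w x)\<^sup>2 \<partial>lborel) - s\<^sup>2 * ((1 / \<delta>) * (\<integral>x. (p x)\<^sup>2 \<partial>lborel))"
        using integral_sq_diff_le(2)[OF \<open>\<delta> > 0\<close> sw square_integrable_cmult[OF sp, of s]]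
        by (simp add: u_def power_mult_distrib mult_ac)
      have D: "(\<Sum>i<m. (\<integral>x. u x * \<eta> i x \<partial>lborel)\<^sup>2) \<le> 2 * (\<Sum>i<m. (\<integral>x. w x * \<eta> i x \<partial>lborel)\<^sup>2)
          + s\<^sup>2 * (2 * (\<Sum>i<m. (\<integral>x. p x * \<eta> i x \<partial>lborel)\<^sup>2))"
      proof -
        have "(\<integral>x. u x * \<eta> i x \<partial>lborel)\<^sup>2 \<le> 2 * (\<integral>x. w x * \<eta> i x \<partial>lborel)\<^sup>2 + s\<^sup>2 * (2 * (\<integral>x. p x * \<eta> i x \<partial>lborel)\<^sup>2)"
          if "i < m" for i
          unfolding lin[OF s\<eta>[OF that]]
          using power2_add_le[of "\<integral>x. w x * \<eta> i x \<partial>lborel" "- s * (\<integral>x. p x * \<eta> i x \<partial>lborel)"]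
          by (simp add: power_mult_distrib mult_ac)
        then have "(\<Sum>i<m. (\<integral>x. u x * \<eta> i x \<partial>lborel)\<^sup>2)
            \<le> (\<Sum>i<m. 2 * (\<integral>x. w x * \<eta> i x \<partial>lborel)\<^sup>2 + s\<^sup>2 * (2 * (\<integral>x. p x * \<eta> i x \<partial>lborel)\<^sup>2))"
          by (intro sum_mono) auto
        then show ?thesis by (simp add: sum.distrib sum_distrib_left)
      qed
      have "lowering W' u = (\<lambda>x. lowering W' w x - s * lowering W' p x)"
        unfolding lowering_def du by (auto simp: u_def algebra_simps)
      then have Y: "(\<integral>x. (lowering W' u x)\<^sup>2 \<partial>lborel) \<le> (1 + \<delta>) * (\<integral>x. (lowering W' w x)\<^sup>2 \<partial>lborel)
          + s\<^sup>2 * ((1 + 1 / \<delta>) * (\<integral>x. (lowering W' p x)\<^sup>2 \<partial>lborel))"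
        using integral_sq_diff_le(1)[OF \<open>\<delta> > 0\<close> sLw square_integrable_cmult[OF sLp, of s]]
        by (simp add: power_mult_distrib mult_ac)
      let ?X = "\<integral>x. (w x)\<^sup>2 \<partial>lborel" and ?Y = "\<integral>x. (lowering W' w x)\<^sup>2 \<partial>lborel"
        and ?D = "\<Sum>i<m. (\<integral>x. w x * \<eta> i x \<partial>lborel)\<^sup>2"
      have nn: "?X \<ge> 0" "?D \<ge> 0" "?Y \<ge> 0" by (auto intro: sum_nonneg)
      have "c1 * (1 - \<delta>) * ?X - (2 * c1 * ?D + K * s\<^sup>2) \<le> (1 + \<delta>) * ?Y"
      proof -
        have "c1 * ((1 - \<delta>) * ?X - s\<^sup>2 * ((1 / \<delta>) * (\<integral>x. (p x)\<^sup>2 \<partial>lborel)))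
          - c1 * (2 * ?D + s\<^sup>2 * (2 * (\<Sum>i<m. (\<integral>x. p x * \<eta> i x \<partial>lborel)\<^sup>2)))
          \<le> c1 * (\<integral>x. (u x)\<^sup>2 \<partial>lborel) - c1 * (\<Sum>i<m. (\<integral>x. u x * \<eta> i x \<partial>lborel)\<^sup>2)"
          using X D \<open>c1 > 0\<close> by (intro diff_mono mult_left_mono) auto
        also note core
        also note Y
        finally show ?thesis by (simp add: K_def algebra_simps)
      qed
      moreover have "(1 + \<delta>) * ((c - \<epsilon>) * ?X) \<le> c1 * (1 - \<delta>) * ?X"
      proof -
        have "c1 * \<delta> = \<epsilon> / 4" using \<open>c1 > 0\<close> by (simp add: \<delta>_def)
        moreover have "c - \<epsilon> = c1 - \<epsilon> / 2" by (simp add: c1_def)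
        then have "c1 * (1 - \<delta>) - (1 + \<delta>) * (c - \<epsilon>) = \<epsilon> / 2 - 2 * (c1 * \<delta>) + \<delta> * (\<epsilon> / 2)"
          by (simp only:) (simp add: field_simps)
        ultimately have "c1 * (1 - \<delta>) - (1 + \<delta>) * (c - \<epsilon>) = \<delta> * (\<epsilon> / 2)" by simp
        moreover have "0 \<le> \<delta> * (\<epsilon> / 2)" using \<open>\<delta> > 0\<close> \<open>\<epsilon> > 0\<close> by simp
        ultimately have "(1 + \<delta>) * (c - \<epsilon>) \<le> c1 * (1 - \<delta>)" by linarith
        then show ?thesis using nn by (metis mult.assoc mult_right_mono)
      qed
      \<comment> \<open>Enlarging the penalty by the factor \<open>1 + \<delta>\<close> lets the
        whole inequality be divided by it.\<close>
      moreover have "2 * c1 * ?D + K * s\<^sup>2 \<le> (1 + \<delta>) * (2 * c1 * ?D + K * s\<^sup>2)"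
      proof -
        have "0 \<le> \<delta> * (2 * c1 * ?D + K * s\<^sup>2)" using nn \<open>\<delta> > 0\<close> \<open>c1 > 0\<close> \<open>K \<ge> 0\<close> by simp
        then show ?thesis by (simp add: distrib_right)
      qed
      ultimately have "(1 + \<delta>) * ((c - \<epsilon>) * ?X - (2 * c1 * ?D + K * s\<^sup>2)) \<le> (1 + \<delta>) * ?Y"
        by (simp only: right_diff_distrib)
      then show ?thesis using \<open>\<delta> > 0\<close> by (simp add: s_def)
    qed
    \<comment> \<open>The weights \<open>2 * c1\<close> and \<open>K\<close> enter as square roots,
      since the pairings get squared; index \<open>m\<close> is the extra direction
      \<open>e\<close>.\<close>
    define \<zeta> where "\<zeta> i x = (if i < m then sqrt (2 * c1) * \<eta> i x else sqrt K * e x)" for i x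
    have reg: "continuous_on UNIV (\<zeta> i) \<and> square_integrable lborel (\<zeta> i)" if "i < Suc m" for i
      using c\<eta>[of i] s\<eta>[of i] ce se unfolding \<zeta>_def
      by (cases "i < m") (auto intro!: continuous_intros square_integrable_cmult)
    have scale: "(\<integral>x. w x * (sqrt r * h x) \<partial>lborel)\<^sup>2 = r * (\<integral>x. w x * h x \<partial>lborel)\<^sup>2"
      if "r \<ge> 0" for r and w h :: "real \<Rightarrow> real"
    proof -
      have "(\<integral>x. w x * (sqrt r * h x) \<partial>lborel) = (\<integral>x. sqrt r * (w x * h x) \<partial>lborel)" by (simp add: mult_ac)
      then show ?thesis using that by (simp add: power_mult_distrib)
    qed
    have sum: "(\<Sum>i<Suc m. (\<integral>x. w x * \<zeta> i x \<partial>lborel)\<^sup>2)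
      = 2 * c1 * (\<Sum>i<m. (\<integral>x. w x * \<eta> i x \<partial>lborel)\<^sup>2) + K * (\<integral>x. w x * e x \<partial>lborel)\<^sup>2" for w
    proof -
      have "(\<integral>x. w x * \<zeta> i x \<partial>lborel)\<^sup>2 = 2 * c1 * (\<integral>x. w x * \<eta> i x \<partial>lborel)\<^sup>2" if "i < m" for i
        using scale[of "2 * c1" w "\<eta> i"] \<open>c1 > 0\<close> that by (simp add: \<zeta>_def)
      moreover have "(\<integral>x. w x * \<zeta> m x \<partial>lborel)\<^sup>2 = K * (\<integral>x. w x * e x \<partial>lborel)\<^sup>2"
        using scale[OF \<open>K \<ge> 0\<close>] by (simp add: \<zeta>_def)
      ultimately show ?thesis by (simp add: sum_distrib_left)
    qed
    show ?thesis using reg est[folded sum] by (intro exI[of _ \<zeta>]) blast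
  qed
qed

section \<open>The harmonic oscillator\<close>

text \<open>Comparison of forms keeps the excluded directions. It is used with
  \<open>k = \<rho>\<close> for the commutator and with \<open>k = \<kappa>\<close> for the
  comparison of potentials.\<close>

lemma codim_bound_shift:
  assumes "codim_bound m c Q" "\<And>w. C1c w \<Longrightarrow> Q w + k * (\<integral>x. (w x)\<^sup>2 \<partial>lborel) \<le> Q' w"
  shows "codim_bound m (c + k) Q'"
  unfolding codim_bound_def
proof (intro allI impI)
  fix \<epsilon> :: real assume "\<epsilon> > 0"
  then obtain \<theta> where \<theta>: "\<forall>i<m. continuous_on UNIV (\<theta> i) \<and> square_integrable lborel (\<theta> i)"
    and low: "\<And>w. C1c w \<Longrightarrow> (c - \<epsilon>) * (\<integral>x. (w x)\<^sup>2 \<partial>lborel) - (\<Sum>i<m. (\<integral>x. w x * \<theta> i x \<partial>lborel)\<^sup>2) \<le> Q w"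
    using assms(1) unfolding codim_bound_def by blast
  have "(c + k - \<epsilon>) * (\<integral>x. (w x)\<^sup>2 \<partial>lborel) - (\<Sum>i<m. (\<integral>x. w x * \<theta> i x \<partial>lborel)\<^sup>2) \<le> Q' w" if "C1c w" for w
    using low[OF that] assms(2)[OF that] by (simp add: algebra_simps)
  then show "\<exists>\<theta>. (\<forall>i<m. continuous_on UNIV (\<theta> i) \<and> square_integrable lborel (\<theta> i)) \<and>
     (\<forall>w. C1c w \<longrightarrow> (c + k - \<epsilon>) * (\<integral>x. (w x)\<^sup>2 \<partial>lborel) - (\<Sum>i<m. (\<integral>x. w x * \<theta> i x \<partial>lborel)\<^sup>2) \<le> Q' w)"
    using \<theta> by blast
qed

text \<open>This is \<open>exp (- 2 W)\<close> for the oscillator, a multiple of the normal density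
  of variance \<open>1 / \<rho>\<close>.\<close>

lemma integrable_gaussian:
  assumes "\<rho> > 0" shows "integrable lborel (\<lambda>x::real. exp (- (2 * (\<rho> * x\<^sup>2 / 4))))"
proof -
  have "integrable lborel (\<lambda>x. sqrt (2 * pi / \<rho>) * normal_density 0 (1 / sqrt \<rho>) x)"
    by (intro integrable_mult_right integrable_normal_density) (use assms in simp)
  moreover have "sqrt (2 * pi / \<rho>) * normal_density 0 (1 / sqrt \<rho>) x = exp (- (2 * (\<rho> * x\<^sup>2 / 4)))" for x
    using assms by (simp add: normal_density_def power_divide real_sqrt_divide mult_ac)
  ultimately show ?thesis by simp
qed

text \<open>Lower bounds matching the oscillator eigenvalues
  \<open>0, \<rho>, 2 \<rho>, ...\<close>: each round of the induction gains \<open>\<rho>\<close>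
  from the commutator and spends one direction.\<close>

lemma codim_bound_oscillator:
  assumes "\<rho> > 0"
  shows "codim_bound m (\<rho> * real m) (\<lambda>w. \<integral>x. (lowering (\<lambda>x. \<rho> * x / 2) w x)\<^sup>2 \<partial>lborel)"
proof (induction m)
  case 0
  \<comment> \<open>Without directions only nonnegativity of the energy is claimed.\<close>
  show ?case unfolding codim_bound_def
  proof (intro allI impI exI conjI)
    fix \<epsilon> :: real and w :: "real \<Rightarrow> real" assume "\<epsilon> > 0"
    have "(\<rho> * real 0 - \<epsilon>) * (\<integral>x. (w x)\<^sup>2 \<partial>lborel) \<le> 0"
      using \<open>\<epsilon> > 0\<close> by (intro mult_nonpos_nonneg) auto
    moreover have "0 \<le> (\<integral>x. (lowering (\<lambda>x. \<rho> * x / 2) w x)\<^sup>2 \<partial>lborel)" by simp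
    ultimately have "(\<rho> * real 0 - \<epsilon>) * (\<integral>x. (w x)\<^sup>2 \<partial>lborel)
        \<le> (\<integral>x. (lowering (\<lambda>x. \<rho> * x / 2) w x)\<^sup>2 \<partial>lborel)" by (rule order_trans)
    then show "(\<rho> * real 0 - \<epsilon>) * (\<integral>x. (w x)\<^sup>2 \<partial>lborel) - (\<Sum>i<(0::nat). (\<integral>x. w x * (\<lambda>_ _. 0) i x \<partial>lborel)\<^sup>2)
        \<le> (\<integral>x. (lowering (\<lambda>x. \<rho> * x / 2) w x)\<^sup>2 \<partial>lborel)"
      by (simp only: lessThan_0 sum.empty diff_zero)
  qed auto
next
  case (Suc m)
  have d: "((\<lambda>x. \<rho> * x / 2) has_real_derivative \<rho> / 2) (at x)" for x
    by (auto intro!: derivative_eq_intros)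
  \<comment> \<open>The identity \<open>a a* = a* a + \<rho>\<close> for forms: the partner
    potentials differ by \<open>2 W'' = \<rho>\<close>.\<close>
  have "(\<integral>x. (lowering (\<lambda>x. \<rho> * x / 2) w x)\<^sup>2 \<partial>lborel) + \<rho> * (\<integral>x. (w x)\<^sup>2 \<partial>lborel)
      = (\<integral>x. (raising (\<lambda>x. \<rho> * x / 2) w x)\<^sup>2 \<partial>lborel)" if w: "C1c w" for w
  proof -
    have i: "integrable lborel (\<lambda>x. ((\<rho> * x / 2)\<^sup>2 - \<rho> / 2) * (w x)\<^sup>2)" "integrable lborel (\<lambda>x. \<rho> * (w x)\<^sup>2)"
      using C1c_Cc[OF w] by (auto intro!: Cc_integrable Cc_intros continuous_intros)
    have "(\<integral>x. ((\<rho> * x / 2)\<^sup>2 + \<rho> / 2) * (w x)\<^sup>2 \<partial>lborel)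
        = (\<integral>x. ((\<rho> * x / 2)\<^sup>2 - \<rho> / 2) * (w x)\<^sup>2 + \<rho> * (w x)\<^sup>2 \<partial>lborel)"
      by (intro Bochner_Integration.integral_cong refl) (simp add: algebra_simps)
    also have "\<dots> = (\<integral>x. ((\<rho> * x / 2)\<^sup>2 - \<rho> / 2) * (w x)\<^sup>2 \<partial>lborel) + (\<integral>x. \<rho> * (w x)\<^sup>2 \<partial>lborel)"
      by (rule Bochner_Integration.integral_add[OF i])
    finally show ?thesis
      using integral_lowering_sq[OF w d] integral_raising_sq[OF w d] by simp
  qed
  then have "codim_bound m (\<rho> * real m + \<rho>) (\<lambda>w. \<integral>x. (raising (\<lambda>x. \<rho> * x / 2) w x)\<^sup>2 \<partial>lborel)"
    using codim_bound_shift[OF Suc.IH] by simp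
  then have "codim_bound (Suc m) (\<rho> * real m + \<rho>) (\<lambda>w. \<integral>x. (lowering (\<lambda>x. \<rho> * x / 2) w x)\<^sup>2 \<partial>lborel)"
    by (intro codim_bound_Suc[where W = "\<lambda>x. \<rho> * x\<^sup>2 / 4"] integrable_gaussian assms)
      (auto intro!: derivative_eq_intros continuous_intros)
  then show ?case by (simp add: algebra_simps)
qed

section \<open>The weighted generator\<close>

lemma smooth_fun_deriv:
  assumes "smooth_fun f"
  shows "(f has_real_derivative deriv f x) (at x)" "smooth_fun (deriv f)"
    "continuous_on UNIV f"
proof -
  have diff: "((deriv ^^ k) f) differentiable (at x)" for k x using assms by (simp add: smooth_fun_def)
  show d: "(f has_real_derivative deriv f x) (at x)" for x
    using diff[of 0 x] DERIV_deriv_iff_real_differentiable by simp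
  show "continuous_on UNIV f" using d by (meson DERIV_isCont continuous_at_imp_continuous_on)
  show "smooth_fun (deriv f)" unfolding smooth_fun_def
  proof (intro allI)
    fix k x show "((deriv ^^ k) (deriv f)) differentiable (at x)"
      using diff[of "Suc k" x] by (simp only: funpow_Suc_right o_apply)
  qed
qed

lemma test_fun_C1c:
  assumes "test_fun f" shows "C1c f" "C1c (deriv f)"
proof -
  have sm: "smooth_fun f" using assms by (simp add: test_fun_def)
  obtain M where M: "\<And>x. f x \<noteq> 0 \<Longrightarrow> \<bar>x\<bar> \<le> M" using assms by (auto simp: test_fun_def bounded_iff)
  have z: "f x = 0" if "M < \<bar>x\<bar>" for x using M[of x] that by force
  note d1 = smooth_fun_deriv[OF sm] and d2 = smooth_fun_deriv[OF smooth_fun_deriv(2)[OF sm]]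
  note d3 = smooth_fun_deriv[OF d2(2)]
  show f: "C1c f" by (rule C1cI(1)[OF d1(1) d2(3) z])
  obtain N where N: "\<And>x. N < \<bar>x\<bar> \<Longrightarrow> deriv f x = 0" using C1c_bound[OF f] by metis
  show "C1c (deriv f)" by (rule C1cI(1)[OF d2(1) d3(3) N])
qed

text \<open>For \<open>W = V / 2\<close>, \<open>hyp\<close> places the potential of
  \<open>A A*\<close> above the oscillator potential \<open>\<rho>^2 x^2 / 4 - \<rho> / 2\<close>
  plus \<open>\<kappa>\<close>. The final transfer to \<open>A* A\<close> spends a direction without
  a gain of \<open>\<rho>\<close>, whence \<open>Suc m\<close> against \<open>m\<close>.\<close>

lemma codim_bound_energy:
  assumes V: "smooth_fun V" and int: "integrable lborel (\<lambda>x. exp (- V x))" and "\<rho> > 0"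
    and hyp: "\<forall>x. deriv (deriv V) x / 2 + (deriv V x)\<^sup>2 / 4 + \<rho> / 2 - \<rho>\<^sup>2 * x\<^sup>2 / 4 \<ge> \<kappa>"
  shows "codim_bound (Suc m) (\<rho> * real m + \<kappa>) (\<lambda>w. \<integral>x. (lowering (\<lambda>x. deriv V x / 2) w x)\<^sup>2 \<partial>lborel)"
proof -
  note V1 = smooth_fun_deriv[OF V] and V2 = smooth_fun_deriv[OF smooth_fun_deriv(2)[OF V]]
  note V3 = smooth_fun_deriv[OF V2(2)]
  have d: "((\<lambda>x. deriv V x / 2) has_real_derivative deriv (deriv V) x / 2) (at x)" for x
    using V2(1)[of x] by (auto intro!: derivative_eq_intros)
  have c: "continuous_on UNIV (\<lambda>x. deriv (deriv V) x / 2)" using V3(3) by (intro continuous_intros) auto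
  have d0: "((\<lambda>x. \<rho> * x / 2) has_real_derivative \<rho> / 2) (at x)" for x
    by (auto intro!: derivative_eq_intros)
  have "(\<integral>x. (lowering (\<lambda>x. \<rho> * x / 2) w x)\<^sup>2 \<partial>lborel) + \<kappa> * (\<integral>x. (w x)\<^sup>2 \<partial>lborel)
      \<le> (\<integral>x. (raising (\<lambda>x. deriv V x / 2) w x)\<^sup>2 \<partial>lborel)" if w: "C1c w" for w
  proof -
    have i: "integrable lborel (\<lambda>x. ((\<rho> * x / 2)\<^sup>2 - \<rho> / 2) * (w x)\<^sup>2)" "integrable lborel (\<lambda>x. \<kappa> * (w x)\<^sup>2)"
      "integrable lborel (\<lambda>x. ((deriv V x / 2)\<^sup>2 + deriv (deriv V) x / 2) * (w x)\<^sup>2)"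
      using C1c_Cc[OF w] V2(3) V3(3) by (auto intro!: Cc_integrable Cc_intros continuous_intros)
    have "(\<integral>x. ((\<rho> * x / 2)\<^sup>2 - \<rho> / 2) * (w x)\<^sup>2 \<partial>lborel) + (\<integral>x. \<kappa> * (w x)\<^sup>2 \<partial>lborel)
        = (\<integral>x. ((\<rho> * x / 2)\<^sup>2 - \<rho> / 2) * (w x)\<^sup>2 + \<kappa> * (w x)\<^sup>2 \<partial>lborel)"
      by (rule Bochner_Integration.integral_add[OF i(1,2), symmetric])
    also have "\<dots> \<le> (\<integral>x. ((deriv V x / 2)\<^sup>2 + deriv (deriv V) x / 2) * (w x)\<^sup>2 \<partial>lborel)"
    proof (intro integral_mono Bochner_Integration.integrable_add i)
      fix x
      have "(\<rho> * x / 2)\<^sup>2 - \<rho> / 2 + \<kappa> \<le> (deriv V x / 2)\<^sup>2 + deriv (deriv V) x / 2"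
        using hyp[rule_format, of x] by (simp add: power_divide power_mult_distrib)
      then have "((\<rho> * x / 2)\<^sup>2 - \<rho> / 2 + \<kappa>) * (w x)\<^sup>2 \<le> ((deriv V x / 2)\<^sup>2 + deriv (deriv V) x / 2) * (w x)\<^sup>2"
        by (rule mult_right_mono) simp
      then show "((\<rho> * x / 2)\<^sup>2 - \<rho> / 2) * (w x)\<^sup>2 + \<kappa> * (w x)\<^sup>2
          \<le> ((deriv V x / 2)\<^sup>2 + deriv (deriv V) x / 2) * (w x)\<^sup>2" by (simp only: distrib_right)
    qed
    finally show ?thesis
      using integral_lowering_sq[OF w d0] integral_raising_sq[OF w d c] by simp
  qed
  then have "codim_bound m (\<rho> * real m + \<kappa>) (\<lambda>w. \<integral>x. (raising (\<lambda>x. deriv V x / 2) w x)\<^sup>2 \<partial>lborel)"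
    by (rule codim_bound_shift[OF codim_bound_oscillator[OF \<open>\<rho> > 0\<close>]])
  then show ?thesis
    by (intro codim_bound_Suc[where W = "\<lambda>x. V x / 2"])
      (use V1(1) V2(3) int in \<open>auto intro!: derivative_eq_intros continuous_intros\<close>)
qed

text \<open>The substitution gives \<open>A w = \<phi>' exp (- V / 2)\<close>, and
  \<open>(\<phi>' exp (- V))' = (L \<phi>) exp (- V)\<close> yields the energy by parts.\<close>

lemma energy_ground_state_transform:
  assumes V: "smooth_fun V" and "test_fun \<phi>"
  defines "w \<equiv> (\<lambda>x. \<phi> x * exp (- V x / 2))"
  shows "C1c w"
    "(\<integral>x. (lowering (\<lambda>x. deriv V x / 2) w x)\<^sup>2 \<partial>lborel) = (\<integral>x. exp (- V x) * (\<phi> x * - gen V \<phi> x) \<partial>lborel)"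
proof -
  note V1 = smooth_fun_deriv[OF V] and V2 = smooth_fun_deriv[OF smooth_fun_deriv(2)[OF V]]
  note \<phi> = test_fun_C1c[OF assms(2)]
  have dE: "((\<lambda>x. exp (- V x / 2)) has_real_derivative - (deriv V x / 2) * exp (- V x / 2)) (at x)" for x
    using V1(1)[of x] by (auto intro!: derivative_eq_intros)
  have cE: "continuous_on UNIV (\<lambda>x. - (deriv V x / 2) * exp (- V x / 2))"
    using V1(3) V2(3) by (intro continuous_intros) auto
  note w = C1c_mult[OF \<phi>(1) dE cE, folded w_def]
  show "C1c w" by (rule w(1))
  have dG: "((\<lambda>x. deriv \<phi> x * exp (- V x)) has_real_derivative gen V \<phi> x * exp (- V x)) (at x)" for x
  proof -
    have "(deriv \<phi> has_real_derivative deriv (deriv \<phi>) x) (at x)" using \<phi>(2) by (simp add: C1c_def)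
    with V1(1)[of x] show ?thesis
      by (auto intro!: derivative_eq_intros simp: gen_def algebra_simps)
  qed
  have cG: "continuous_on UNIV (\<lambda>x. gen V \<phi> x * exp (- V x))"
    unfolding gen_def using \<phi> V1(3) V2(3)
    by (auto intro!: continuous_intros simp: C1c_def dest!: Cc_continuous)
  have "(lowering (\<lambda>x. deriv V x / 2) w x)\<^sup>2 = deriv \<phi> x * (deriv \<phi> x * exp (- V x))" for x
  proof -
    have "lowering (\<lambda>x. deriv V x / 2) w x = deriv \<phi> x * exp (- V x / 2)"
      unfolding lowering_def w(2) by (simp add: w_def algebra_simps)
    moreover have "(exp (- V x / 2))\<^sup>2 = exp (- V x)" by (simp flip: exp_of_nat_mult)
    ultimately show ?thesis by (simp only: power_mult_distrib) (simp add: power2_eq_square)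
  qed
  then have "(\<integral>x. (lowering (\<lambda>x. deriv V x / 2) w x)\<^sup>2 \<partial>lborel) = - (\<integral>x. \<phi> x * (gen V \<phi> x * exp (- V x)) \<partial>lborel)"
    using integral_by_parts_C1c[OF \<phi>(1) dG cG] by simp
  then show "(\<integral>x. (lowering (\<lambda>x. deriv V x / 2) w x)\<^sup>2 \<partial>lborel) = (\<integral>x. exp (- V x) * (\<phi> x * - gen V \<phi> x) \<partial>lborel)"
    by (simp add: mult_ac)
qed

section \<open>Integrals against \<open>mu V\<close> and passage to the closure of the
  generator\<close>

context
  fixes V :: "real \<Rightarrow> real" assumes V: "smooth_fun V"
begin

private lemma borel_V: "V \<in> borel_measurable borel"
  using smooth_fun_deriv(3)[OF V] by (rule continuous_on_imp_borel)

lemma square_integrable_mu: "square_integrable (mu V) f \<longleftrightarrow> L2 V f"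
  by (simp add: square_integrable_def L2_def mu_def)

lemma integral_mu:
  assumes "f \<in> borel_measurable borel"
  shows "(\<integral>x. f x \<partial>mu V) = (\<integral>x. exp (- V x) * f x \<partial>lborel) / (\<integral>x. exp (- V x) \<partial>lborel)"
proof -
  have "(\<integral>x. f x \<partial>mu V) = (\<integral>x. exp (- V x) / (\<integral>x. exp (- V x) \<partial>lborel) * f x \<partial>lborel)"
    unfolding mu_def using assms borel_V by (intro integral_real_density) (auto intro!: AE_I2)
  then show ?thesis by simp
qed

lemma L2I:
  assumes "f \<in> borel_measurable borel" "integrable lborel (\<lambda>x. exp (- V x) * (f x)\<^sup>2)"
  shows "L2 V f"
  unfolding L2_def mu_def using assms borel_V
  by (subst integrable_real_density) (auto intro!: AE_I2)

lemma Cc_L2: "Cc f \<Longrightarrow> L2 V f"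
  using smooth_fun_deriv(3)[OF V]
  by (intro L2I Cc_integrable continuous_on_imp_borel) (auto intro!: Cc_intros continuous_intros dest: Cc_continuous)

end

text \<open>The penalised inequality is stable when \<open>\<phi> k\<close> and
  \<open>L \<phi> k\<close> converge in \<open>L2\<close>. The approximants need not be orthogonal
  to the \<open>g i\<close>: the limit is, so the penalties tend to 0.\<close>

lemma Lgraph_lower_bound:
  assumes V: "smooth_fun V" and graph: "Lgraph V f h" and nz: "(\<integral>x. (f x)\<^sup>2 \<partial>mu V) \<noteq> 0"
    and g: "\<And>i. i < n \<Longrightarrow> L2 V (g i)" and orth: "\<And>i. i < n \<Longrightarrow> (\<integral>x. f x * g i x \<partial>mu V) = 0"
    and low: "\<And>\<phi>. test_fun \<phi> \<Longrightarrow> c * (\<integral>x. exp (- V x) * (\<phi> x)\<^sup>2 \<partial>lborel)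
        - (\<Sum>i<n. (\<integral>x. exp (- V x) * (\<phi> x * g i x) \<partial>lborel)\<^sup>2) \<le> (\<integral>x. exp (- V x) * (\<phi> x * - gen V \<phi> x) \<partial>lborel)"
  shows "c \<le> (\<integral>x. f x * - h x \<partial>mu V) / (\<integral>x. (f x)\<^sup>2 \<partial>mu V)"
proof -
  define Z where "Z = (\<integral>x. exp (- V x) \<partial>lborel)"
  obtain \<phi> where \<phi>: "\<And>k. test_fun (\<phi> k)" and f: "L2 V f" and h: "L2 V h"
    and lim: "(\<lambda>k. \<integral>x. (\<phi> k x - f x)\<^sup>2 \<partial>mu V) \<longlonglongrightarrow> 0"
    and limL: "(\<lambda>k. \<integral>x. (gen V (\<phi> k) x - h x)\<^sup>2 \<partial>mu V) \<longlonglongrightarrow> 0"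
    using graph unfolding Lgraph_def by blast
  have borel: "u \<in> borel_measurable borel" if "L2 V u" for u using that by (simp add: L2_def)
  have "Z \<ge> 0" by (simp add: Z_def)
  \<comment> \<open>With \<open>Z = 0\<close>, division by zero in \<open>integral_mu\<close> would
    make the squared norm of \<open>f\<close> zero, against \<open>nz\<close>.\<close>
  moreover have "Z \<noteq> 0"
    using nz integral_mu[OF V, of "\<lambda>x. (f x)\<^sup>2"] borel[OF f] by (auto simp: Z_def)
  ultimately have "Z > 0" by simp
  have c\<phi>: "Cc (\<phi> k)" and cL: "Cc (gen V (\<phi> k))" for k
    unfolding gen_def using test_fun_C1c[OF \<phi>[of k]] smooth_fun_deriv(3)[OF smooth_fun_deriv(2)[OF V]]
    by (auto simp: C1c_def intro!: Cc_intros)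
  have l\<phi>: "L2 V (\<phi> k)" and lL: "L2 V (gen V (\<phi> k))" for k using Cc_L2[OF V] c\<phi> cL by auto
  note tendsto = square_integrable_tendsto_mult[where M = "mu V", unfolded square_integrable_mu[OF V]]
  have l1: "(\<lambda>k. \<integral>x. (\<phi> k x)\<^sup>2 \<partial>mu V) \<longlonglongrightarrow> (\<integral>x. (f x)\<^sup>2 \<partial>mu V)"
    unfolding power2_eq_square by (rule tendsto[OF f f l\<phi> l\<phi> lim lim])
  have l2: "(\<lambda>k. \<integral>x. \<phi> k x * - gen V (\<phi> k) x \<partial>mu V) \<longlonglongrightarrow> (\<integral>x. f x * - h x \<partial>mu V)"
    using tendsto_minus[OF tendsto[OF f h l\<phi> lL lim limL]] by simp
  have l3: "(\<lambda>k. \<integral>x. \<phi> k x * g i x \<partial>mu V) \<longlonglongrightarrow> 0" if "i < n" for i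
    using tendsto[OF f g[OF that] l\<phi> g[OF that] lim] orth[OF that] by simp
  \<comment> \<open>The inequality \<open>low\<close> is divided by \<open>Z\<close>; a squared
    pairing carries \<open>1 / Z\<close> twice, so a factor \<open>Z\<close> remains before the
    penalties.\<close>
  have "c * (\<integral>x. (\<phi> k x)\<^sup>2 \<partial>mu V) - Z * (\<Sum>i<n. (\<integral>x. \<phi> k x * g i x \<partial>mu V)\<^sup>2)
      \<le> (\<integral>x. \<phi> k x * - gen V (\<phi> k) x \<partial>mu V)" for k
  proof -
    have 1: "(\<integral>x. (\<phi> k x)\<^sup>2 \<partial>mu V) = (\<integral>x. exp (- V x) * (\<phi> k x)\<^sup>2 \<partial>lborel) / Z"
      using integral_mu[OF V, of "\<lambda>x. (\<phi> k x)\<^sup>2"] borel[OF l\<phi>[of k]] by (simp add: Z_def)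
    have 2: "(\<integral>x. \<phi> k x * - gen V (\<phi> k) x \<partial>mu V) = (\<integral>x. exp (- V x) * (\<phi> k x * - gen V (\<phi> k) x) \<partial>lborel) / Z"
      using borel[OF l\<phi>[of k]] borel[OF lL[of k]] unfolding Z_def
      by (intro integral_mu[OF V, of "\<lambda>x. \<phi> k x * - gen V (\<phi> k) x"] borel_measurable_times borel_measurable_uminus)
    have 3: "Z * (\<integral>x. \<phi> k x * g i x \<partial>mu V)\<^sup>2 = (\<integral>x. exp (- V x) * (\<phi> k x * g i x) \<partial>lborel)\<^sup>2 / Z" if "i < n" for i
    proof -
      have "(\<integral>x. \<phi> k x * g i x \<partial>mu V) = (\<integral>x. exp (- V x) * (\<phi> k x * g i x) \<partial>lborel) / Z"
        using borel[OF l\<phi>[of k]] borel[OF g[OF that]] unfolding Z_def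
        by (intro integral_mu[OF V, of "\<lambda>x. \<phi> k x * g i x"]) measurable
      then show ?thesis using \<open>Z > 0\<close> by (simp add: power2_eq_square)
    qed
    have "Z * (\<Sum>i<n. (\<integral>x. \<phi> k x * g i x \<partial>mu V)\<^sup>2)
        = (\<Sum>i<n. (\<integral>x. exp (- V x) * (\<phi> k x * g i x) \<partial>lborel)\<^sup>2) / Z"
      unfolding sum_distrib_left sum_divide_distrib using 3 by (intro sum.cong) auto
    then show ?thesis
      unfolding 1 2 using divide_right_mono[OF low[OF \<phi>[of k]] less_imp_le[OF \<open>Z > 0\<close>]]
      by (simp add: diff_divide_distrib)
  qed
  moreover have "(\<lambda>k. c * (\<integral>x. (\<phi> k x)\<^sup>2 \<partial>mu V) - Z * (\<Sum>i<n. (\<integral>x. \<phi> k x * g i x \<partial>mu V)\<^sup>2))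
      \<longlonglongrightarrow> c * (\<integral>x. (f x)\<^sup>2 \<partial>mu V) - Z * (\<Sum>i<n. 0\<^sup>2)"
    by (intro tendsto_intros l1 l3) auto
  ultimately have "c * (\<integral>x. (f x)\<^sup>2 \<partial>mu V) \<le> (\<integral>x. f x * - h x \<partial>mu V)"
    using LIMSEQ_le[OF _ l2] by fastforce
  moreover have "(\<integral>x. (f x)\<^sup>2 \<partial>mu V) > 0" using nz by (simp add: order_less_le)
  ultimately show ?thesis by (simp only: pos_le_divide_eq)
qed

theorem mainTheorem9:
  fixes V :: "real \<Rightarrow> real" and \<rho> \<kappa> :: real
  assumes "smooth_fun V"
    and "integrable lborel (\<lambda>x. exp (- V x))"
    and "lambda V 1 > 0"
    and "\<rho> > 0"
    and "\<forall>x. deriv (deriv V) x / 2 + (deriv V x)\<^sup>2 / 4 + \<rho> / 2 - \<rho>\<^sup>2 * x\<^sup>2 / 4 \<ge> \<kappa>"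
  shows "\<forall>n::nat. n \<ge> 1 \<longrightarrow> lambda V n \<ge> ereal (\<rho> * (real n - 1) + \<kappa>)"
proof (intro allI impI)
  fix n :: nat assume "n \<ge> 1"
  \<comment> \<open>Of the \<open>n\<close> directions, \<open>m\<close> come from the oscillator
    and one from the last transfer.\<close>
  then obtain m where n: "n = Suc m" by (cases n) auto
  define c where "c = \<rho> * (real n - 1) + \<kappa>"
  note V = assms(1)
  have V_cont: "continuous_on UNIV V" by (rule smooth_fun_deriv(3)[OF V])
  have bound: "codim_bound n c (\<lambda>w. \<integral>x. (lowering (\<lambda>x. deriv V x / 2) w x)\<^sup>2 \<partial>lborel)"
    using codim_bound_energy[OF assms(1,2,4,5), of m] by (simp add: c_def n)
  show "ereal (\<rho> * (real n - 1) + \<kappa>) \<le> lambda V n"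
    unfolding c_def[symmetric]
  proof (rule ereal_le_epsilon2)
    fix \<epsilon> :: real assume "\<epsilon> > 0"
    then obtain \<theta> where \<theta>: "\<And>i. i < n \<Longrightarrow> continuous_on UNIV (\<theta> i)" "\<And>i. i < n \<Longrightarrow> square_integrable lborel (\<theta> i)"
      and low: "\<And>w. C1c w \<Longrightarrow> (c - \<epsilon>) * (\<integral>x. (w x)\<^sup>2 \<partial>lborel) - (\<Sum>i<n. (\<integral>x. w x * \<theta> i x \<partial>lborel)\<^sup>2)
        \<le> (\<integral>x. (lowering (\<lambda>x. deriv V x / 2) w x)\<^sup>2 \<partial>lborel)"
      using bound unfolding codim_bound_def by blast
    \<comment> \<open>Undoes the substitution \<open>w = \<phi> exp (- V / 2)\<close>: the pairing
      of \<open>w\<close> with \<open>\<theta> i\<close> is that of \<open>\<phi>\<close> with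
      \<open>g i\<close> under the weight \<open>exp (- V)\<close>.\<close>
    define g where "g i x = \<theta> i x * exp (V x / 2)" for i x
    have half: "exp (V x / 2) * exp (V x / 2) = exp (V x)" "exp (- V x / 2) * exp (- V x / 2) = exp (- V x)"
      "exp (- V x) * exp (V x / 2) = exp (- V x / 2)" for x
      by (simp_all flip: exp_add)
    have g: "L2 V (g i)" if "i < n" for i
    proof (rule L2I[OF V])
      show "g i \<in> borel_measurable borel" unfolding g_def
        using \<theta>(1)[OF that] V_cont by (intro continuous_on_imp_borel continuous_intros) auto
      have "exp (- V x) * (g i x)\<^sup>2 = (\<theta> i x)\<^sup>2" for x
        using half(1)[of x] by (simp add: g_def power2_eq_square exp_minus field_simps)
      then show "integrable lborel (\<lambda>x. exp (- V x) * (g i x)\<^sup>2)"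
        using \<theta>(2)[OF that] by (simp add: square_integrable_def)
    qed
    have low': "(c - \<epsilon>) * (\<integral>x. exp (- V x) * (\<phi> x)\<^sup>2 \<partial>lborel)
        - (\<Sum>i<n. (\<integral>x. exp (- V x) * (\<phi> x * g i x) \<partial>lborel)\<^sup>2) \<le> (\<integral>x. exp (- V x) * (\<phi> x * - gen V \<phi> x) \<partial>lborel)"
      if "test_fun \<phi>" for \<phi>
    proof -
      have sq: "(\<phi> x * exp (- V x / 2))\<^sup>2 = exp (- V x) * (\<phi> x)\<^sup>2" for x
        using half(2)[of x] by (simp add: power2_eq_square mult_ac)
      have prod: "\<phi> x * exp (- V x / 2) * \<theta> i x = exp (- V x) * (\<phi> x * g i x)" for i x
        unfolding g_def half(3)[symmetric] by (simp add: mult_ac)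
      show ?thesis
        using low[OF energy_ground_state_transform(1)[OF V that]]
        unfolding energy_ground_state_transform(2)[OF V that] sq prod .
    qed
    \<comment> \<open>This \<open>g\<close> is one competitor in the supremum, so a bound on all
      Rayleigh quotients orthogonal to it suffices.\<close>
    have "ereal (c - \<epsilon>) \<le> (INF r \<in> rayleigh_set V n g. ereal r)"
    proof (rule INF_greatest)
      fix r assume "r \<in> rayleigh_set V n g"
      then obtain f h where r: "r = (\<integral>x. f x * - h x \<partial>mu V) / (\<integral>x. (f x)\<^sup>2 \<partial>mu V)"
        and fh: "Lgraph V f h" "(\<integral>x. (f x)\<^sup>2 \<partial>mu V) \<noteq> 0" "\<And>i. i < n \<Longrightarrow> (\<integral>x. f x * g i x \<partial>mu V) = 0"
        unfolding rayleigh_set_def by blast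
      show "ereal (c - \<epsilon>) \<le> ereal r"
        unfolding r ereal_less_eq(3) by (rule Lgraph_lower_bound[OF V fh(1,2) g fh(3) low'])
    qed
    also have "\<dots> \<le> lambda V n"
      unfolding lambda_def using \<open>n \<ge> 1\<close> g by (auto intro!: SUP_upper)
    finally have "ereal (c - \<epsilon>) + ereal \<epsilon> \<le> lambda V n + ereal \<epsilon>" by (rule add_right_mono)
    then show "ereal c \<le> lambda V n + ereal \<epsilon>" by simp
  qed
qed

end
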